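(* Let $n,k$ be positive integers with $k>1$, and let $p$ denote the straight polyomino of size $k$. Then the $(p,n)$-prismatic polyominoes are straight polyominoes of size $n^k+k-1$, and there are $(n!)^{n^{k-1}}$ possible colorings of this shape making it $(p,n)$-prismatic.
   Context: Cells are the unit squares of the square lattice, indexed by integer coordinates $(x,y)$. A polyomino is a finite nonempty edge-connected set of cells; its size is its number of cells; polyominoes are considered up to translation. A straight polyomino of size $k\ge2$ consists of $k$ consecutive cells in a single horizontal row. For a positive integer $n$, an $n$-coloring of a set of cells is a function assigning each cell a color in $\{1,\dots,n\}$. An instance of a shape $p$ is a translate of $p$; if a colored set $P$ contains an instance $S$ of $p$, then $S$ is colored by the restriction of $P$'s coloring, and two instances of $p$ have the same coloring if the coloring agrees under the translation between them. A de Bruijn polyomino for $(p,n)$ is an $n$-colored polyomino which contains exactly one instance of each of the $n^{|p|}$ distinct $n$-colorings of $p$. A $(p,n)$-prismatic polyomino is a de Bruijn polyomino for $(p,n)$ of minimum size. *)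

theory Defs
  imports Main "HOL-Library.FuncSet" "HOL-Library.Product_Plus"
begin

type_synonym cell = "int \<times> int"

definition edge_adjacent :: "cell \<Rightarrow> cell \<Rightarrow> bool" where
  "edge_adjacent u v \<longleftrightarrow> \<bar>fst u - fst v\<bar> + \<bar>snd u - snd v\<bar> = 1"

definition edge_connected :: "cell set \<Rightarrow> bool" where
  "edge_connected P \<longleftrightarrow>
     (\<forall>u\<in>P. \<forall>v\<in>P. (u, v) \<in> {(a, b). a \<in> P \<and> b \<in> P \<and> edge_adjacent a b}\<^sup>*)"

text \<open>
  A polyomino is represented by any of its translates; all notions below are invariant under
  translation of the cell sets (and of their colorings).
\<close>

definition polyomino :: "cell set \<Rightarrow> bool" where
  "polyomino P \<longleftrightarrow> finite P \<and> P \<noteq> {} \<and> edge_connected P"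

definition translate :: "cell \<Rightarrow> cell set \<Rightarrow> cell set" where
  "translate v P = (\<lambda>z. z + v) ` P"

definition straight_polyomino :: "nat \<Rightarrow> cell set \<Rightarrow> bool" where
  "straight_polyomino k P \<longleftrightarrow> (\<exists>x y. P = {x..<x + int k} \<times> {y})"

text \<open>
  Colorings are extensional functions (undefined outside the colored set), so that distinct
  functions are distinct colorings and colorings can be counted.
\<close>

definition colorings :: "cell set \<Rightarrow> nat \<Rightarrow> (cell \<Rightarrow> nat) set" where
  "colorings P n = P \<rightarrow>\<^sub>E {1..n}"

text \<open>
  \<open>S\<close> is an instance of \<open>p\<close> in the set \<open>P\<close> colored by \<open>c\<close>, and the coloring of \<open>S\<close> agrees with
  the coloring \<open>f\<close> of \<open>p\<close> under the translation between them.
\<close>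

definition colored_instance ::
  "cell set \<Rightarrow> (cell \<Rightarrow> nat) \<Rightarrow> cell set \<Rightarrow> (cell \<Rightarrow> nat) \<Rightarrow> cell set \<Rightarrow> bool" where
  "colored_instance p f P c S \<longleftrightarrow>
     S \<subseteq> P \<and> (\<exists>v. S = translate v p \<and> (\<forall>z\<in>p. c (z + v) = f z))"

definition de_bruijn_polyomino :: "cell set \<Rightarrow> nat \<Rightarrow> cell set \<Rightarrow> (cell \<Rightarrow> nat) \<Rightarrow> bool" where
  "de_bruijn_polyomino p n P c \<longleftrightarrow>
     polyomino P \<and> c \<in> colorings P n \<and>
     (\<forall>f\<in>colorings p n. \<exists>!S. colored_instance p f P c S)"

definition prismatic :: "cell set \<Rightarrow> nat \<Rightarrow> cell set \<Rightarrow> (cell \<Rightarrow> nat) \<Rightarrow> bool" where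
  "prismatic p n P c \<longleftrightarrow>
     de_bruijn_polyomino p n P c \<and>
     (\<forall>Q d. de_bruijn_polyomino p n Q d \<longrightarrow> card P \<le> card Q)"

end

(* A set of cells containing N > 0 horizontal rows of k cells has at least N + k - 1 cells: the
   k - 1 cells following the last starting cell of a row are not starting cells themselves.
   Equality leaves no room for a second run, so the set is a single run.

   It remains to count the sequences of length N + k - 1, N = n^k, containing each word of length k
   once. Listing the words in order of occurrence closes up to a cycle, so such a sequence is a
   start word together with a permutation pi of the words which sends each word to one of its
   successors and is a single N-cycle. Let Pi be the matrix of pi and E the matrix with ones in
   column 0 and zeros elsewhere. Then det (I - Pi + E) is N if pi is an N-cycle and 0 otherwise, so
   the required number is the sum of these determinants over all pi. Exchanging the values of pi at
   two words with the same successors shows that this sum does not change when Pi is replaced by its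
   average P, the transition matrix of the walk appending random letters. That walk forgets its
   state after k steps, which makes P - E nilpotent, so that det (I - P + E) = 1. Hence the
   number is the number of all admissible permutations, one bijection of an n-set for each of
   the n^(k-1) classes of words. *)
theory Submission
  imports Defs "Jordan_Normal_Form.Char_Poly" "HOL-Combinatorics.Orbits"
begin

subsection \<open>Determinants averaged over permutations\<close>

text \<open>In the expansion along row \<open>a\<close> the cofactors ignore that row. One family
  \<open>C\<close> therefore serves every \<open>v\<close>, and determinants that differ only in row
  \<open>a\<close> can be subtracted and summed as linear forms.\<close>

lemma det_row_linear:
  fixes Z :: "nat \<Rightarrow> nat \<Rightarrow> 'a :: comm_ring_1"
  assumes a: "a < N"
  obtains C where "\<And>v. det (mat N N (\<lambda>(i,j). if i = a then v j else Z i j)) = (\<Sum>j<N. v j * C j)"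
proof
  fix v
  let ?A = "mat N N (\<lambda>(i,j). if i = a then v j else Z i j)"
  let ?Z = "mat N N (\<lambda>(i,j). Z i j)"
  have "det ?A = (\<Sum>j<N. ?A $$ (a,j) * cofactor ?A a j)"
    by (rule laplace_expansion_row) (use a in auto)
  also have "\<dots> = (\<Sum>j<N. v j * cofactor ?Z a j)"
  proof (rule sum.cong[OF refl])
    fix j assume j: "j \<in> {..<N}"
    have "mat_delete ?A a j = mat_delete ?Z a j"
      unfolding mat_delete_def by (rule eq_matI) (use a j in auto)
    then show "?A $$ (a,j) * cofactor ?A a j = v j * cofactor ?Z a j"
      using a j by (simp add: cofactor_def)
  qed
  finally show "det ?A = (\<Sum>j<N. v j * cofactor ?Z a j)" .
qed

text \<open>Precomposing \<open>g\<close> with the transposition of \<open>a\<close> and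
  \<open>c\<close> is an involution of \<open>G\<close> that negates the determinant. Row
  \<open>a\<close> changes sign; row \<open>c\<close> does not depend on \<open>g\<close> if
  \<open>c\<close> lies in \<open>B\<close>, and otherwise adding row \<open>a\<close> to it
  restores its old value. The sum is thus its own negative.\<close>

lemma sum_det_swap_zero:
  fixes r R Y :: "nat \<Rightarrow> nat \<Rightarrow> complex"
  assumes a: "a < N" and c: "c < N" and ac: "a \<noteq> c"
    and swap: "\<And>g. g \<in> G \<Longrightarrow> g \<circ> Transposition.transpose a c \<in> G"
  shows "(\<Sum>g\<in>G. det (mat N N (\<lambda>(i,j). if i = a then Y (g a) j - Y (g c) j
           else if i \<in> B then R i j else r i j - Y (g i) j))) = 0"
    (is "(\<Sum>g\<in>G. ?D g) = 0")
proof -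
  let ?t = "Transposition.transpose a c"
  have neg: "?D (g \<circ> ?t) = - ?D g" for g
  proof -
    define Z where "Z = (\<lambda>i j. if i \<in> B then R i j else r i j - Y (g (?t i)) j)"
    obtain C where C: "\<And>v. det (mat N N (\<lambda>(i,j). if i = a then v j else Z i j)) = (\<Sum>j<N. v j * C j)"
      using det_row_linear[OF a] by blast
    have "?D (g \<circ> ?t) = det (mat N N (\<lambda>(i,j). if i = a then Y (g c) j - Y (g a) j else Z i j))"
      by (rule arg_cong[where f = det]) (auto simp: Z_def)
    also have "\<dots> = - det (mat N N (\<lambda>(i,j). if i = a then Y (g a) j - Y (g c) j else Z i j))"
      unfolding C by (simp add: sum_negf[symmetric] algebra_simps)
    also have "det (mat N N (\<lambda>(i,j). if i = a then Y (g a) j - Y (g c) j else Z i j)) = ?D g"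
    proof (cases "c \<in> B")
      case True
      then show ?thesis
        by (intro arg_cong[where f = det] eq_matI) (auto simp: Z_def Transposition.transpose_def)
    next
      case False
      let ?A = "mat N N (\<lambda>(i,j). if i = a then Y (g a) j - Y (g c) j else Z i j)"
      have "det (addrow 1 c a ?A) = det ?A"
        by (rule det_addrow) (use a c ac in auto)
      also have "addrow 1 c a ?A = mat N N (\<lambda>(i,j). if i = a then Y (g a) j - Y (g c) j
           else if i \<in> B then R i j else r i j - Y (g i) j)"
        using False a c ac
        by (intro eq_matI) (auto simp: Z_def Transposition.transpose_def mat_addrow_def)
      finally show ?thesis by simp
    qed
    finally show ?thesis .
  qed
  have tt: "g \<circ> ?t \<circ> ?t = g" for g :: "nat \<Rightarrow> nat"
    by (simp add: comp_assoc)
  have "(\<Sum>g\<in>G. ?D g) = (\<Sum>g\<in>G. ?D (g \<circ> ?t))"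
    by (rule sum.reindex_bij_witness[where i = "\<lambda>g. g \<circ> ?t" and j = "\<lambda>g. g \<circ> ?t"])
       (simp_all only: tt swap)
  also have "\<dots> = - (\<Sum>g\<in>G. ?D g)"
    by (simp only: neg sum_negf)
  finally show ?thesis by simp
qed

text \<open>Rows are averaged one at a time, \<open>B\<close> being the set of rows already
  replaced. Replacing row \<open>a\<close> changes \<open>s\<close> times the sum by a sum, over the
  class of \<open>a\<close>, of determinants with \<open>Y (g a) - Y (g c)\<close> in row
  \<open>a\<close>; each of these vanishes after summation over \<open>G\<close>, even if row
  \<open>c\<close> has been averaged before.\<close>

lemma sum_det_average:
  fixes r P Y :: "nat \<Rightarrow> nat \<Rightarrow> complex" and q :: "nat \<Rightarrow> 'b"
  assumes s: "s \<noteq> 0"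
    and swap: "\<And>g a c. g \<in> G \<Longrightarrow> a < N \<Longrightarrow> c < N \<Longrightarrow> q a = q c \<Longrightarrow>
                 g \<circ> Transposition.transpose a c \<in> G"
    and card: "\<And>a. a < N \<Longrightarrow> of_nat (card {c. c < N \<and> q c = q a}) = s"
    and avg: "\<And>g a j. g \<in> G \<Longrightarrow> a < N \<Longrightarrow> j < N \<Longrightarrow>
                 (\<Sum>c | c < N \<and> q c = q a. Y (g c) j) = s * P a j"
  shows "(\<Sum>g\<in>G. det (mat N N (\<lambda>(i,j). r i j - Y (g i) j))) =
         of_nat (card G) * det (mat N N (\<lambda>(i,j). r i j - P i j))"
proof -
  let ?M = "\<lambda>B g. mat N N (\<lambda>(i,j). if i \<in> B then r i j - P i j else r i j - Y (g i) j)"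
  have "(\<Sum>g\<in>G. det (?M B g)) = (\<Sum>g\<in>G. det (?M {} g))" if "finite B" "B \<subseteq> {..<N}" for B
    using that
  proof (induction B)
    case (insert a B)
    then have a: "a < N" and aB: "a \<notin> B" by auto
    let ?D = "\<lambda>c g. det (mat N N (\<lambda>(i,j). if i = a then Y (g a) j - Y (g c) j
           else if i \<in> B then r i j - P i j else r i j - Y (g i) j))"
    let ?cl = "{c. c < N \<and> q c = q a}"
    have D0: "(\<Sum>g\<in>G. ?D c g) = 0" if c: "c < N" "q c = q a" for c
    proof (cases "c = a")
      case False
      then show ?thesis
        using c a swap by (intro sum_det_swap_zero) auto
    next
      case True
      have "?D a g = 0" for g
      proof -
        obtain C where C: "\<And>v. det (mat N N (\<lambda>(i,j). if i = a then v j else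
            (if i \<in> B then r i j - P i j else r i j - Y (g i) j))) = (\<Sum>j<N. v j * C j)"
          using det_row_linear[OF a, where Z = "\<lambda>i j. if i \<in> B then r i j - P i j else r i j - Y (g i) j"] by blast
        show ?thesis unfolding C by simp
      qed
      then show ?thesis unfolding True by simp
    qed
    have diff: "s * (det (?M (insert a B) g) - det (?M B g)) = (\<Sum>c\<in>?cl. ?D c g)" if g: "g \<in> G" for g
    proof -
      define Z where "Z = (\<lambda>i j. if i \<in> B then r i j - P i j else r i j - Y (g i) j)"
      obtain C where C: "\<And>v. det (mat N N (\<lambda>(i,j). if i = a then v j else Z i j)) = (\<Sum>j<N. v j * C j)"
        using det_row_linear[OF a] by blast
      have 1: "?M (insert a B) g = mat N N (\<lambda>(i,j). if i = a then r a j - P a j else Z i j)"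
        and 2: "?M B g = mat N N (\<lambda>(i,j). if i = a then r a j - Y (g a) j else Z i j)"
        using aB by (auto simp: Z_def intro!: eq_matI)
      have 3: "?D c g = (\<Sum>j<N. (Y (g a) j - Y (g c) j) * C j)" for c
        unfolding C[symmetric] Z_def by (rule arg_cong[where f = det]) auto
      have "(\<Sum>c\<in>?cl. ?D c g) = (\<Sum>j<N. (\<Sum>c\<in>?cl. Y (g a) j - Y (g c) j) * C j)"
        unfolding 3 sum_distrib_right by (rule sum.swap)
      also have "\<dots> = (\<Sum>j<N. s * ((Y (g a) j - P a j) * C j))"
        using card[OF a] avg[OF g a] by (intro sum.cong) (auto simp: sum_subtractf algebra_simps)
      finally show ?thesis
        unfolding 1 2 C by (simp add: sum_distrib_left sum_subtractf[symmetric] algebra_simps)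
    qed
    have "s * ((\<Sum>g\<in>G. det (?M (insert a B) g)) - (\<Sum>g\<in>G. det (?M B g))) =
          (\<Sum>g\<in>G. \<Sum>c\<in>?cl. ?D c g)"
      unfolding sum_subtractf[symmetric] sum_distrib_left by (rule sum.cong[OF refl diff])
    also have "\<dots> = (\<Sum>c\<in>?cl. \<Sum>g\<in>G. ?D c g)"
      by (rule sum.swap)
    also have "\<dots> = 0"
      using D0 by (intro sum.neutral) auto
    finally show ?case
      using s insert by simp
  qed simp
  from this[of "{..<N}"]
  have "(\<Sum>g\<in>G. det (?M {..<N} g)) = (\<Sum>g\<in>G. det (?M {} g))"
    by simp
  moreover have "?M {..<N} g = mat N N (\<lambda>(i,j). r i j - P i j)" for g
    by (rule eq_matI) auto
  ultimately show ?thesis by simp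
qed

text \<open>Left multiplication by the triangular matrix \<open>?V\<close> of ones, which has
  determinant 1, telescopes the rows. The product is lower triangular with diagonal
  \<open>N, 1, ..., 1\<close>.\<close>

lemma det_full_cycle:
  "det (mat N N (\<lambda>(i,j). of_bool (i = j) + of_bool (j = 0) - of_bool (Suc i mod N = j))) =
     (of_nat N :: complex)" (is "det ?M = _") if N: "N > 0"
proof -
  let ?V = "mat N N (\<lambda>(i,j). of_bool (i \<le> j)) :: complex mat"
  have VM: "(?V * ?M) $$ (i,j) = (if j = 0 then of_bool (i = 0) + of_nat (N - i) - 1 else of_bool (i = j))"
    if ij: "i < N" "j < N" for i j
  proof -
    have "(?V * ?M) $$ (i,j) = (\<Sum>l<N. of_bool (i \<le> l) * (of_bool (l = j) + of_bool (j = 0) - of_bool (Suc l mod N = j)))"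
      using ij by (simp add: scalar_prod_def lessThan_atLeast0)
    also have "\<dots> = (\<Sum>l<N. of_bool (l = j \<and> i \<le> j)) + (\<Sum>l<N. of_bool (i \<le> l \<and> j = 0)) -
        (\<Sum>l<N. of_bool (i \<le> l \<and> Suc l mod N = j))"
      unfolding sum.distrib[symmetric] sum_subtractf[symmetric] by (rule sum.cong) auto
    also have "(\<Sum>l<N. of_bool (l = j \<and> i \<le> j)) = (of_bool (i \<le> j) :: complex)"
      using ij by (simp add: of_bool_conj)
    also have "(\<Sum>l<N. of_bool (i \<le> l \<and> j = 0)) = (of_nat (card {i..<N}) * of_bool (j = 0) :: complex)"
    proof -
      have "{l. l < N \<and> i \<le> l} = {i..<N}" by auto
      then show ?thesis by (auto simp: of_bool_def sum.If_cases Int_def)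
    qed
    also have "(\<Sum>l<N. of_bool (i \<le> l \<and> Suc l mod N = j)) = (of_bool (j = 0 \<or> i < j) :: complex)"
    proof -
      \<comment> \<open>The only candidate for \<open>l\<close> is the cyclic predecessor of
        \<open>j\<close>. For \<open>j = 0\<close> it is \<open>N - 1\<close>, which is never below
        \<open>i\<close>.\<close>
      have "(i \<le> l \<and> Suc l mod N = j) = (l = (if j = 0 then N - 1 else j - 1) \<and> (j = 0 \<or> i < j))"
        if "l < N" for l
        using ij that by (cases "Suc l = N") auto
      then have "(\<Sum>l<N. of_bool (i \<le> l \<and> Suc l mod N = j)) =
          (\<Sum>l<N. of_bool (l = (if j = 0 then N - 1 else j - 1)) * (of_bool (j = 0 \<or> i < j) :: complex))"
        by (intro sum.cong) (simp_all add: of_bool_conj)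
      also have "\<dots> = of_bool (j = 0 \<or> i < j)"
        using ij by (simp add: sum_distrib_right[symmetric])
      finally show ?thesis .
    qed
    finally show ?thesis
      using ij by auto
  qed
  have "det (?V * ?M) = prod_list (diag_mat (?V * ?M))"
    by (rule det_lower_triangular[of N]) (use VM in \<open>auto simp del: index_mult_mat(1)\<close>)
  also have "diag_mat (?V * ?M) = of_nat N # replicate (N - 1) 1"
    unfolding diag_mat_def using N VM
    by (intro nth_equalityI) (auto simp: nth_Cons' simp del: index_mult_mat(1))
  finally have "det (?V * ?M) = of_nat N"
    by (simp add: prod_list_replicate)
  moreover have "det ?V = 1"
  proof -
    have "det ?V = prod_list (diag_mat ?V)"
      by (rule det_upper_triangular[of _ N]) (auto intro!: upper_triangularI)
    also have "diag_mat ?V = replicate N 1"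
      unfolding diag_mat_def by (intro nth_equalityI) auto
    finally show ?thesis by (simp add: prod_list_replicate)
  qed
  ultimately show ?thesis
    using det_mult[of ?V N ?M] by simp
qed

subsection \<open>Laplacians of permutations and of the de Bruijn walk\<close>

lemma append_digit_less:
  fixes n u m b :: nat
  assumes "u < m" and "b < n"
  shows "n * u + b < n * m"
proof -
  have "n * u + b < n * Suc u" using assms by simp
  also have "\<dots> \<le> n * m" using assms by (intro mult_le_mono2) simp
  finally show ?thesis .
qed

text \<open>The first return time of \<open>e\<close> equals the size of its orbit, and that orbit
  is all of \<open>{..<N}\<close>.\<close>

lemma cyclic_on_lessThan_funpow:
  assumes cyc: "cyclic_on \<pi> {..<N}" and e: "e < N"
  shows "bij_betw (\<lambda>i. (\<pi> ^^ i) e) {..<N} {..<N}" and "(\<pi> ^^ N) e = e"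
proof -
  have orb: "orbit \<pi> e = {..<N}"
    using cyc e by (intro orbit_cyclic_eq3) auto
  then have ee: "e \<in> orbit \<pi> e" using e by simp
  let ?d = "funpow_dist1 \<pi> e e"
  have inj: "inj_on (\<lambda>i. (\<pi> ^^ i) e) {0..<?d}"
    by (rule inj_on_funpow_dist1[OF ee])
  have im: "{..<N} = (\<lambda>i. (\<pi> ^^ i) e) ` {0..<?d}"
    using orbit_conv_funpow_dist1[OF ee] orb by simp
  have d: "?d = N"
    using card_image[OF inj] unfolding im[symmetric] by simp
  show "bij_betw (\<lambda>i. (\<pi> ^^ i) e) {..<N} {..<N}"
    using inj im unfolding d by (simp add: bij_betw_def lessThan_atLeast0)
  show "(\<pi> ^^ N) e = e"
    using funpow_dist1_prop[OF ee] unfolding d .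
qed

text \<open>Rows and columns are permuted alike, so the sign enters twice and cancels; the columns
  are treated as rows of the transpose.\<close>

lemma det_simultaneous_permutation:
  fixes A :: "nat \<Rightarrow> nat \<Rightarrow> 'a :: comm_ring_1"
  assumes c: "bij_betw c {..<N} {..<N}"
  shows "det (mat N N (\<lambda>(i,j). A (c i) (c j))) = det (mat N N (\<lambda>(i,j). A i j))"
proof -
  \<comment> \<open>Only the values of \<open>c\<close> below \<open>N\<close> are controlled; the
    identity elsewhere turns it into a permutation in the sense of \<open>permutes\<close>.\<close>
  define p where "p = (\<lambda>i. if i < N then c i else i)"
  have p: "p permutes {0..<N}"
    using bij_betw_cong[of "{..<N}" c p "{..<N}"] c
    by (intro bij_imp_permutes) (auto simp: p_def lessThan_atLeast0)
  have pN: "p i < N" if "i < N" for i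
    using permutes_in_image[OF p, of i] that by simp
  let ?A = "mat N N (\<lambda>(i,j). A i j)"
  let ?B = "mat N N (\<lambda>(i,j). A i (p j))"
  have "mat N N (\<lambda>(i,j). A (c i) (c j)) = mat N N (\<lambda>(i,j). ?B $$ (p i, j))"
    using pN by (intro eq_matI) (auto simp: p_def)
  also have "det \<dots> = signof p * det ?B"
    by (rule det_permute_rows[OF _ p]) simp
  also have "det ?B = det (transpose_mat ?B)"
    by (rule det_transpose[of _ N, symmetric]) simp
  also have "transpose_mat ?B = mat N N (\<lambda>(i,j). transpose_mat ?A $$ (p i, j))"
    using pN by (intro eq_matI) auto
  also have "det \<dots> = signof p * det (transpose_mat ?A)"
    by (rule det_permute_rows[OF _ p]) simp
  also have "det (transpose_mat ?A) = det ?A"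
    by (rule det_transpose[of _ N]) simp
  also have "signof p * (signof p * det ?A) = det ?A"
    by (cases p rule: sign_cases) simp_all
  finally show ?thesis .
qed

text \<open>The column of ones added in column 0 removes the constant vectors from the kernel of
  \<open>I - \<Pi>\<close>; the indicator of the complement of the cycle through 0 stays in it.\<close>

lemma det_permutation_laplacian:
  fixes \<pi> :: "nat \<Rightarrow> nat"
  assumes \<pi>: "\<pi> permutes {..<N}" and N: "N > 0"
  shows "det (mat N N (\<lambda>(i,j). of_bool (i = j) + of_bool (j = 0) - of_bool (\<pi> i = j))) =
           (if cyclic_on \<pi> {..<N} then of_nat N else (0 :: complex))"
proof (cases "cyclic_on \<pi> {..<N}")
  case True
  let ?c = "\<lambda>i. (\<pi> ^^ i) 0"
  let ?A = "\<lambda>i j. of_bool (i = j) + of_bool (j = 0) - of_bool (\<pi> i = j) :: complex"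
  note c = cyclic_on_lessThan_funpow[OF True N]
  have inj: "?c i = ?c j \<longleftrightarrow> i = j" if "i < N" "j < N" for i j
    using c(1) that unfolding bij_betw_def inj_on_def by auto
  have step: "\<pi> (?c i) = ?c (Suc i mod N)" if "i < N" for i
    using that c(2) by (cases "Suc i = N") auto
  \<comment> \<open>Renumbering the points along the orbit of 0 turns \<open>\<pi>\<close> into the
    successor modulo \<open>N\<close> and keeps 0 in place, so that the added column of ones stays
    in column 0.\<close>
  have "det (mat N N (\<lambda>(i,j). ?A i j)) = det (mat N N (\<lambda>(i,j). ?A (?c i) (?c j)))"
    by (rule det_simultaneous_permutation[OF c(1), symmetric])
  also have "mat N N (\<lambda>(i,j). ?A (?c i) (?c j)) =
      mat N N (\<lambda>(i,j). of_bool (i = j) + of_bool (j = 0) - of_bool (Suc i mod N = j))"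
  proof (rule eq_matI, goal_cases)
    case (1 i j)
    then have ij: "i < N" "j < N" by auto
    have "?c j = 0 \<longleftrightarrow> j = 0" using inj[OF ij(2) N] by simp
    moreover have "\<pi> (?c i) = ?c j \<longleftrightarrow> Suc i mod N = j"
      unfolding step[OF ij(1)] using N by (intro inj ij) simp
    ultimately show ?case using ij inj[OF ij] by simp
  qed auto
  finally show ?thesis
    using True det_full_cycle[OF N] by simp
next
  case False
  let ?O = "orbit \<pi> 0"
  let ?M = "mat N N (\<lambda>(i,j). of_bool (i = j) + of_bool (j = 0) - of_bool (\<pi> i = j)) :: complex mat"
  let ?v = "vec N (\<lambda>i. of_bool (i \<notin> ?O)) :: complex vec"
  have perm: "permutation \<pi>"
    using \<pi> by (auto simp: permutation_permutes)
  have O0: "0 \<in> ?O"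
    by (rule permutation_self_in_orbit[OF perm])
  have sub: "?O \<subseteq> {..<N}"
    using permutes_orbit_subset[OF \<pi>] N by simp
  have "?O \<noteq> {..<N}"
    using False N unfolding cyclic_on_def by fastforce
  then obtain x where x: "x < N" "x \<notin> ?O"
    using sub by auto
  \<comment> \<open>With this invariance the contributions of \<open>i\<close> and
    \<open>\<pi> i\<close> to entry \<open>i\<close> of the product cancel, and column 0 contributes
    nothing because 0 lies in its own orbit.\<close>
  have inv: "\<pi> i \<in> ?O \<longleftrightarrow> i \<in> ?O" for i
    using cyclic_on_f_in[OF \<pi> cyclic_on_orbit'[OF perm]] orbit.step by metis
  have "?M *\<^sub>v ?v = 0\<^sub>v N"
  proof (rule eq_vecI)
    fix i assume "i < dim_vec (0\<^sub>v N)"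
    then have i: "i < N" by simp
    have \<pi>i: "\<pi> i < N"
      using permutes_in_image[OF \<pi>, of i] i by simp
    have "(?M *\<^sub>v ?v) $ i =
        (\<Sum>j<N. (of_bool (i = j) + of_bool (j = 0) - of_bool (\<pi> i = j)) * of_bool (j \<notin> ?O))"
      using i by (simp add: scalar_prod_def lessThan_atLeast0)
    also have "\<dots> = (\<Sum>j<N. if i = j then of_bool (j \<notin> ?O) else 0) +
        (\<Sum>j<N. if 0 = j then of_bool (j \<notin> ?O) else 0) -
        (\<Sum>j<N. if \<pi> i = j then of_bool (j \<notin> ?O) else 0)"
      unfolding sum.distrib[symmetric] sum_subtractf[symmetric] by (rule sum.cong) auto
    also have "\<dots> = 0"
      using i \<pi>i N O0 inv[of i] by simp
    finally show "(?M *\<^sub>v ?v) $ i = 0\<^sub>v N $ i" using i by simp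
  qed simp
  moreover have "?v \<noteq> 0\<^sub>v N"
  proof
    assume "?v = 0\<^sub>v N"
    then have "?v $ x = 0\<^sub>v N $ x" by simp
    with x show False by simp
  qed
  moreover have "?v \<in> carrier_vec N" "?M \<in> carrier_mat N N"
    by simp_all
  ultimately have "det ?M = 0"
    using det_0_iff_vec_prod_zero[of ?M N] by blast
  with False show ?thesis by simp
qed

text \<open>The hypothesis excludes nonzero eigenvalues. Over the complex numbers the characteristic
  polynomial splits, hence is a power of the variable, and its value at 1 is the determinant in
  question.\<close>

lemma det_one_minus_nilpotent:
  fixes T :: "complex mat"
  assumes T: "T \<in> carrier_mat N N"
    and nil: "\<And>v l. v \<in> carrier_vec N \<Longrightarrow> T *\<^sub>v v = l \<cdot>\<^sub>v v \<Longrightarrow> l \<noteq> 0 \<Longrightarrow> v = 0\<^sub>v N"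
  shows "det (1\<^sub>m N - T) = 1"
proof -
  obtain as where as: "char_poly T = (\<Prod>a\<leftarrow>as. [:- a, 1:])"
    using char_poly_factorized[OF T] by blast
  have "a = 0" if a: "a \<in> set as" for a
  proof (rule ccontr)
    assume a0: "a \<noteq> 0"
    have "poly (char_poly T) a = 0"
      unfolding as using a by (rule linear_poly_root)
    then have "eigenvalue T a"
      using eigenvalue_root_char_poly[OF T] by simp
    then obtain v where "eigenvector T v a"
      unfolding eigenvalue_def by blast
    then show False
      using nil[of v a] a0 T by (auto simp: eigenvector_def)
  qed
  then have "as = replicate (length as) 0"
    by (intro replicate_eqI) auto
  then have "char_poly T = [:0, 1:] ^ length as"
    unfolding as by (metis map_replicate prod_list_replicate minus_zero)
  then have "poly (char_poly T) 1 = 1" by simp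
  also have "poly (char_poly T) 1 = det (- char_matrix T 1)"
    by (rule char_poly_matrix[OF T])
  also have "- char_matrix T 1 = 1\<^sub>m N - T"
    unfolding char_matrix_def using T by (intro eq_matI) auto
  finally show ?thesis .
qed

text \<open>\<open>T\<close> averages a vector over the \<open>n\<close> successors of a word and
  subtracts its entry at 0. An eigenvector for \<open>l \<noteq> 0\<close> inherits from
  \<open>T\<close> that its entries depend on ever fewer final letters, so it is constant; on
  constants \<open>T\<close> is zero, so the eigenvector vanishes.\<close>

lemma det_de_bruijn_walk:
  fixes n K :: nat
  defines "N \<equiv> n ^ Suc K"
  assumes n: "n > 0"
  shows "det (mat N N (\<lambda>(i,j). of_bool (i = j) + of_bool (j = 0) -
           of_bool (j div n = i mod n ^ K) / of_nat n)) = (1 :: complex)"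
proof -
  have N: "N > 0" "N = n ^ K * n" using n by (simp_all add: N_def)
  have lt: "n * (i mod n ^ K) + b < N" if "b < n" for i b
    using append_digit_less[OF _ that, of "i mod n ^ K" "n ^ K"] n by (simp add: N_def)
  define T :: "complex mat" where
    "T = mat N N (\<lambda>(i,j). of_bool (j div n = i mod n ^ K) / of_nat n - of_bool (j = 0))"
  have T: "T \<in> carrier_mat N N" by (simp add: T_def)
  have Tv: "(T *\<^sub>v v) $ i = (\<Sum>b<n. v $ (n * (i mod n ^ K) + b)) / of_nat n - v $ 0"
    if v: "v \<in> carrier_vec N" and i: "i < N" for v i
  proof -
    let ?S = "{j. j < N \<and> j div n = i mod n ^ K}"
    have "(T *\<^sub>v v) $ i = (\<Sum>j<N. (of_bool (j div n = i mod n ^ K) / of_nat n - of_bool (j = 0)) * v $ j)"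
      using i v by (simp add: T_def scalar_prod_def lessThan_atLeast0)
    also have "\<dots> = (\<Sum>j<N. if j div n = i mod n ^ K then v $ j / of_nat n else 0) -
        (\<Sum>j<N. if 0 = j then v $ j else 0)"
      unfolding sum_subtractf[symmetric] by (rule sum.cong) (auto simp: algebra_simps)
    also have "(\<Sum>j<N. if 0 = j then v $ j else 0) = v $ 0"
      using N by simp
    also have "(\<Sum>j<N. if j div n = i mod n ^ K then v $ j / of_nat n else 0) =
        (\<Sum>j\<in>?S. v $ j / of_nat n)"
      by (rule sum.mono_neutral_cong_right) auto
    also have "\<dots> = (\<Sum>b<n. v $ (n * (i mod n ^ K) + b) / of_nat n)"
    proof (rule sum.reindex_bij_witness[where i = "\<lambda>b. n * (i mod n ^ K) + b" and j = "\<lambda>j. j mod n"], goal_cases)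
      case (4 b)
      then show ?case using n lt[of b i] by simp
    next
      case (1 j)
      then have e: "i mod n ^ K = j div n" by simp
      show ?case unfolding e by simp
    next
      case (5 j)
      then have e: "i mod n ^ K = j div n" by simp
      show ?case unfolding e by simp
    qed (use n in auto)
    finally show ?thesis by (simp add: sum_divide_distrib)
  qed
  have "v = 0\<^sub>v N" if v: "v \<in> carrier_vec N" and ev: "T *\<^sub>v v = l \<cdot>\<^sub>v v" and l: "l \<noteq> 0" for v l
  proof -
    have lv: "l * v $ i = (\<Sum>b<n. v $ (n * (i mod n ^ K) + b)) / of_nat n - v $ 0" if "i < N" for i
      using Tv[OF v that] v that unfolding ev by simp
    \<comment> \<open>Induction on the number \<open>t\<close> of forgotten leading letters. Equal
      last \<open>Suc K - Suc t\<close> letters of \<open>i\<close> and \<open>i'\<close> give,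
      after appending the same \<open>b\<close>, successors with equal last \<open>Suc K - t\<close>
      letters.\<close>
    have const: "v $ i = v $ i'"
      if "t \<le> Suc K" "i < N" "i' < N" "i mod n ^ (Suc K - t) = i' mod n ^ (Suc K - t)" for t i i'
      using that
    proof (induction t arbitrary: i i')
      case 0
      then show ?case by (simp add: N_def)
    next
      case (Suc t)
      define s where "s = K - t"
      have s: "Suc K - Suc t = s" "Suc K - t = Suc s" "s \<le> K"
        using Suc.prems by (auto simp: s_def)
      have dv: "n ^ s dvd n ^ K" using s by (simp add: le_imp_power_dvd)
      have mod_eq: "(n * (i mod n ^ K) + b) mod n ^ Suc s = (n * (i' mod n ^ K) + b) mod n ^ Suc s" for b
      proof -
        have "n * (i mod n ^ K) mod n ^ Suc s = n * (i mod n ^ K mod n ^ s)" for i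
          by (simp only: power_Suc mult_mod_right[of n "i mod n ^ K" "n ^ s"])
        then have "n * (i mod n ^ K) mod n ^ Suc s = n * (i' mod n ^ K) mod n ^ Suc s"
          using Suc.prems(4) dv unfolding s by (simp add: mod_mod_cancel)
        then show ?thesis by (metis mod_add_left_eq)
      qed
      have "v $ (n * (i mod n ^ K) + b) = v $ (n * (i' mod n ^ K) + b)" if "b < n" for b
      proof (rule Suc.IH)
        show "t \<le> Suc K" using Suc.prems(1) by simp
        show "(n * (i mod n ^ K) + b) mod n ^ (Suc K - t) = (n * (i' mod n ^ K) + b) mod n ^ (Suc K - t)"
          unfolding s(2) by (rule mod_eq)
      qed (rule lt[OF that])+
      then have "l * v $ i = l * v $ i'"
        using Suc.prems lv by simp
      with l show ?case by simp
    qed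
    \<comment> \<open>For \<open>t = Suc K\<close> the modulus is \<open>n ^ 0 = 1\<close>, so any
      two indices are compared.\<close>
    have const0: "v $ i = v $ 0" if "i < N" for i
      using const[of "Suc K" i 0] that N by simp
    have "v $ i = 0" if i: "i < N" for i
    proof -
      have "v $ (n * (i mod n ^ K) + b) = v $ 0" if "b < n" for b
        by (rule const0[OF lt[OF that]])
      then have "l * v $ i = 0"
        using lv[OF i] n by simp
      with l show ?thesis by simp
    qed
    then show ?thesis
      using v by (intro eq_vecI) auto
  qed
  then have "det (1\<^sub>m N - T) = 1"
    by (rule det_one_minus_nilpotent[OF T])
  also have "1\<^sub>m N - T = mat N N (\<lambda>(i,j). of_bool (i = j) + of_bool (j = 0) -
           of_bool (j div n = i mod n ^ K) / of_nat n)"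
    by (rule eq_matI) (auto simp: T_def)
  finally show ?thesis .
qed

subsection \<open>De Bruijn sequences\<close>

lemma permutes_lessThanI:
  fixes f :: "nat \<Rightarrow> nat"
  assumes "\<And>x. x < n \<Longrightarrow> f x < n" "inj_on f {..<n}" "\<And>x. \<not> x < n \<Longrightarrow> f x = x"
  shows "f permutes {..<n}"
proof (rule bij_imp_permutes)
  have "f ` {..<n} = {..<n}"
    using assms by (intro endo_inj_surj) auto
  then show "bij_betw f {..<n} {..<n}"
    using assms by (simp add: bij_betw_def)
qed (use assms in auto)

lemma append_digit_eq_iff:
  fixes n u b :: nat
  assumes "b < n" "b' < n"
  shows "n * u + b = n * u' + b' \<longleftrightarrow> u = u' \<and> b = b'"
proof
  assume "n * u + b = n * u' + b'"
  then have "(n * u + b) div n = (n * u' + b') div n" "(n * u + b) mod n = (n * u' + b') mod n"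
    by simp_all
  with assms show "u = u' \<and> b = b'" by simp
qed simp

text \<open>A word of length \<open>K + 1\<close> over \<open>n\<close> letters is encoded as a number below \<open>n ^ Suc K\<close> with its
  first letter as most significant digit; \<open>v\<close> can follow \<open>w\<close> iff \<open>v div n = w mod n ^ K\<close>.\<close>

definition de_bruijn_perms :: "nat \<Rightarrow> nat \<Rightarrow> (nat \<Rightarrow> nat) set" where
  "de_bruijn_perms n K =
     {\<pi>. \<pi> permutes {..<n ^ Suc K} \<and> (\<forall>w<n ^ Suc K. \<pi> w div n = w mod n ^ K)}"

text \<open>The words read off a linear sequence of \<open>n ^ Suc K + K\<close> letters in order of
  position; the step from the last word to the first is left free. The functions are extensional so
  that they can be counted.\<close>

definition de_bruijn_seqs :: "nat \<Rightarrow> nat \<Rightarrow> (nat \<Rightarrow> nat) set" where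
  "de_bruijn_seqs n K =
     {w \<in> {..<n ^ Suc K} \<rightarrow>\<^sub>E {..<n ^ Suc K}. inj_on w {..<n ^ Suc K} \<and>
        (\<forall>i. Suc i < n ^ Suc K \<longrightarrow> w (Suc i) div n = w i mod n ^ K)}"

text \<open>Split \<open>w\<close> into its first letter \<open>w div m\<close> and its remainder
  \<open>u = w mod m\<close>. The \<open>n\<close> words with remainder \<open>u\<close> share the
  successors \<open>n * u + b\<close>, so an admissible permutation is an independent choice, for
  each \<open>u\<close>, of a permutation of the letters; \<open>F\<close> and \<open>H\<close>
  translate between the two.\<close>

lemma card_de_bruijn_perms:
  assumes n: "n > 0"
  shows "card (de_bruijn_perms n K) = fact n ^ (n ^ K)"
proof -
  define m where "m = n ^ K"
  define N where "N = n ^ Suc K"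
  have m: "m > 0" and N: "N = n * m" using n by (simp_all add: m_def N_def)
  let ?T = "{..<m} \<rightarrow>\<^sub>E {t. t permutes {..<n}}"
  define F :: "(nat \<Rightarrow> nat \<Rightarrow> nat) \<Rightarrow> nat \<Rightarrow> nat" where
    "F = (\<lambda>t w. if w < N then n * (w mod m) + t (w mod m) (w div m) else w)"
  \<comment> \<open>The value \<open>a\<close> for arguments beyond the alphabet is what
    \<open>permutes\<close> demands.\<close>
  define H :: "(nat \<Rightarrow> nat) \<Rightarrow> nat \<Rightarrow> nat \<Rightarrow> nat" where
    "H = (\<lambda>\<pi>. \<lambda>u\<in>{..<m}. \<lambda>a. if a < n then \<pi> (m * a + u) mod n else a)"
  have G: "de_bruijn_perms n K = {\<pi>. \<pi> permutes {..<N} \<and> (\<forall>w<N. \<pi> w div n = w mod m)}"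
    by (simp add: de_bruijn_perms_def N_def m_def)
  have divn: "w div m < n" if "w < N" for w
    using that by (simp add: N less_mult_imp_div_less)
  have lt: "m * a + u < N" if "a < n" "u < m" for a u
    using append_digit_less[OF that] by (simp add: N mult.commute)
  have tn: "t u a < n" if "t \<in> ?T" "u < m" "a < n" for t u a
  proof -
    have "t u permutes {..<n}" using that by auto
    from permutes_in_image[OF this, of a] that show ?thesis by simp
  qed
  have "bij_betw F ?T (de_bruijn_perms n K)"
  proof (rule bij_betw_byWitness[where f' = H])
    show "\<forall>t\<in>?T. H (F t) = t"
    proof
      fix t assume t: "t \<in> ?T"
      show "H (F t) = t"
      proof (intro ext)
        fix u a
        show "H (F t) u a = t u a"
        proof (cases "u < m")
          case False
          then show ?thesis using PiE_arb[OF t, of u] by (simp add: H_def)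
        next
          case True
          then have "t u permutes {..<n}" using t by auto
          then show ?thesis
            using True lt[of a u] tn[OF t True, of a] m
            by (auto simp: H_def F_def permutes_def)
        qed
      qed
    qed
    show "\<forall>\<pi>\<in>de_bruijn_perms n K. F (H \<pi>) = \<pi>"
    proof
      fix \<pi> assume \<pi>: "\<pi> \<in> de_bruijn_perms n K"
      show "F (H \<pi>) = \<pi>"
      proof
        fix w
        show "F (H \<pi>) w = \<pi> w"
        proof (cases "w < N")
          case True
          have "F (H \<pi>) w = n * (w mod m) + \<pi> w mod n"
            using True divn[OF True] m by (simp add: F_def H_def)
          also have "w mod m = \<pi> w div n" using \<pi> True by (simp add: G)
          finally show ?thesis by simp
        next
          case False
          then show ?thesis using \<pi> by (auto simp: F_def G permutes_def)
        qed
      qed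
    qed
    show "F ` ?T \<subseteq> de_bruijn_perms n K"
    proof safe
      fix t assume t: "t \<in> ?T"
      have tw: "t (w mod m) (w div m) < n" if "w < N" for w
        using tn[OF t _ divn[OF that]] m by simp
      have "F t permutes {..<N}"
      proof (rule permutes_lessThanI)
        show "F t w < N" if "w < N" for w
          using that append_digit_less[OF _ tw[OF that], of "w mod m" m] m by (simp add: F_def N)
        show "inj_on (F t) {..<N}"
        proof (rule inj_onI)
          fix w w' assume w: "w \<in> {..<N}" "w' \<in> {..<N}" "F t w = F t w'"
          then have "n * (w mod m) + t (w mod m) (w div m) = n * (w' mod m) + t (w' mod m) (w' div m)"
            by (simp add: F_def)
          with w tw[of w] tw[of w'] append_digit_eq_iff
          have "w mod m = w' mod m \<and> t (w mod m) (w div m) = t (w' mod m) (w' div m)"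
            by blast
          moreover have "t (w mod m) permutes {..<n}"
            using PiE_mem[OF t, of "w mod m"] m by simp
          then have "inj (t (w mod m))" by (rule permutes_inj)
          ultimately show "w = w'"
            by (metis injD mult_div_mod_eq)
        qed
      qed (simp add: F_def)
      moreover have "F t w div n = w mod m" if "w < N" for w
        using that tw[OF that] n by (simp add: F_def)
      ultimately show "F t \<in> de_bruijn_perms n K" by (simp add: G)
    qed
    show "H ` de_bruijn_perms n K \<subseteq> ?T"
    proof (rule image_subsetI)
      fix \<pi> assume \<pi>: "\<pi> \<in> de_bruijn_perms n K"
      then have p: "\<pi> permutes {..<N}" and s: "\<And>w. w < N \<Longrightarrow> \<pi> w div n = w mod m"
        by (auto simp: G)
      have "H \<pi> u permutes {..<n}" if u: "u < m" for u
      proof (rule permutes_lessThanI)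
        show "H \<pi> u a < n" if "a < n" for a using that n u by (simp add: H_def)
        show "inj_on (H \<pi> u) {..<n}"
        proof (rule inj_onI)
          fix a a' assume a: "a \<in> {..<n}" "a' \<in> {..<n}" "H \<pi> u a = H \<pi> u a'"
          have "\<pi> (m * a + u) mod n = \<pi> (m * a' + u) mod n"
            using a u by (simp add: H_def)
          moreover have "\<pi> (m * a + u) div n = \<pi> (m * a' + u) div n"
            using a u s[OF lt[of a u]] s[OF lt[of a' u]] by simp
          ultimately have "\<pi> (m * a + u) = \<pi> (m * a' + u)"
            by (metis mult_div_mod_eq)
          then have "m * a + u = m * a' + u"
            using permutes_inj[OF p] by (simp add: inj_eq)
          then show "a = a'" using m by simp
        qed
      qed (use u in \<open>simp add: H_def\<close>)
      then show "H \<pi> \<in> ?T" by (auto simp: H_def PiE_iff)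
    qed
  qed
  then have "card (de_bruijn_perms n K) = card ?T"
    by (simp add: bij_betw_same_card)
  also have "\<dots> = fact n ^ m"
    by (simp add: card_PiE card_permutations[of "{..<n}" n])
  finally show ?thesis by (simp add: m_def)
qed

text \<open>The Laplacian determinants are summed over all admissible permutations in two ways. Each
  cyclic one contributes \<open>N\<close> and the others 0; by averaging, the sum is also the number
  of admissible permutations times the determinant 1 of the walk.\<close>

lemma card_cyclic_de_bruijn_perms:
  assumes n: "n > 0"
  shows "n ^ Suc K * card {\<pi> \<in> de_bruijn_perms n K. cyclic_on \<pi> {..<n ^ Suc K}} =
           card (de_bruijn_perms n K)"
proof -
  define m where "m = n ^ K"
  define N where "N = n ^ Suc K"
  have m: "m > 0" and N: "N = n * m" and N0: "N > 0" using n by (simp_all add: m_def N_def)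
  define G where "G = de_bruijn_perms n K"
  have G: "G = {\<pi>. \<pi> permutes {..<N} \<and> (\<forall>w<N. \<pi> w div n = w mod m)}"
    by (simp add: de_bruijn_perms_def N_def m_def G_def)
  have fin: "finite G"
    unfolding G by (rule finite_subset[OF _ finite_permutations[of "{..<N}"]]) auto
  let ?d = "\<lambda>\<pi>. det (mat N N (\<lambda>(i,j). of_bool (i = j) + of_bool (j = 0) - of_bool (\<pi> i = j))) :: complex"
  have "(\<Sum>\<pi>\<in>G. ?d \<pi>) = of_nat (card G) * det (mat N N (\<lambda>(i,j). of_bool (i = j) + of_bool (j = 0) -
           of_bool (j div n = i mod m) / of_nat n))"
  \<comment> \<open>The classes of \<open>q\<close> consist of the words that differ at most in the
    first letter. Such words have the same successors, so exchanging their values keeps a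
    permutation admissible.\<close>
  proof (rule sum_det_average[where s = "of_nat n" and q = "\<lambda>w. w mod m"
        and Y = "\<lambda>l j. of_bool (l = j)"])
    show "of_nat n \<noteq> (0 :: complex)" using n by simp
    show "\<pi> \<circ> Transposition.transpose a c \<in> G"
      if "\<pi> \<in> G" "a < N" "c < N" "a mod m = c mod m" for \<pi> a c
    proof -
      have "\<pi> \<circ> Transposition.transpose a c permutes {..<N}"
        using that by (intro permutes_compose permutes_swap_id) (auto simp: G)
      moreover have "(\<pi> \<circ> Transposition.transpose a c) w div n = w mod m" if "w < N" for w
        using that \<open>\<pi> \<in> G\<close> \<open>a < N\<close> \<open>c < N\<close> \<open>a mod m = c mod m\<close>
        by (cases "w = a"; cases "w = c") (auto simp: G)
      ultimately show ?thesis by (simp add: G)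
    qed
    show "of_nat (card {c. c < N \<and> c mod m = a mod m}) = (of_nat n :: complex)" for a
    proof -
      have "{c. c < N \<and> c mod m = a mod m} = (\<lambda>b. m * b + a mod m) ` {..<n}"
      proof (intro equalityI subsetI)
        fix c assume c: "c \<in> {c. c < N \<and> c mod m = a mod m}"
        then have "c div m < n" by (simp add: N less_mult_imp_div_less)
        moreover have "c = m * (c div m) + a mod m"
          using c mult_div_mod_eq[of m c] by simp
        ultimately show "c \<in> (\<lambda>b. m * b + a mod m) ` {..<n}" by blast
      next
        fix c assume "c \<in> (\<lambda>b. m * b + a mod m) ` {..<n}"
        then show "c \<in> {c. c < N \<and> c mod m = a mod m}"
          using append_digit_less[of _ n "a mod m" m] m by (auto simp: N mult.commute)
      qed
      moreover have "inj_on (\<lambda>b. m * b + a mod m) {..<n}"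
        using m by (auto simp: inj_on_def)
      ultimately show ?thesis by (simp add: card_image)
    qed
    show "(\<Sum>c | c < N \<and> c mod m = a mod m. of_bool (\<pi> c = j)) =
            of_nat n * (of_bool (j div n = a mod m) / of_nat n :: complex)"
      if \<pi>: "\<pi> \<in> G" and j: "j < N" for \<pi> a j
    proof -
      have p: "\<pi> permutes {..<N}" using \<pi> by (simp add: G)
      \<comment> \<open>The sum may run over all words, since \<open>\<pi> c = j\<close> forces
        \<open>c mod m = j div n\<close>; as \<open>\<pi>\<close> is a permutation, \<open>j\<close>
        is then hit exactly once.\<close>
      have "(\<Sum>c | c < N \<and> c mod m = a mod m. of_bool (\<pi> c = j) :: complex) =
          (\<Sum>c<N. of_bool (j div n = a mod m) * of_bool (\<pi> c = j))"
        using \<pi> by (intro sum.mono_neutral_cong_left) (auto simp: G)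
      also have "\<dots> = of_bool (j div n = a mod m) * (\<Sum>c<N. of_bool (\<pi> c = j))"
        by (simp only: sum_distrib_left)
      also have "(\<Sum>c<N. of_bool (\<pi> c = j)) = (\<Sum>c<N. of_bool (c = j) :: complex)"
        by (rule sum.permute[OF p, unfolded comp_def, symmetric])
      also have "\<dots> = 1" using j by (simp add: of_bool_def)
      finally show ?thesis using n by simp
    qed
  qed
  also have "\<dots> = of_nat (card G)"
    using det_de_bruijn_walk[OF n, of K] by (simp add: N_def m_def)
  also have "(\<Sum>\<pi>\<in>G. ?d \<pi>) = (\<Sum>\<pi>\<in>G. if cyclic_on \<pi> {..<N} then of_nat N else 0)"
    using N0 by (intro sum.cong refl det_permutation_laplacian) (auto simp: G)
  also have "\<dots> = of_nat (N * card {\<pi>\<in>G. cyclic_on \<pi> {..<N}})"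
    using fin by (simp add: sum.If_cases Int_def mult.commute)
  finally show ?thesis
    unfolding of_nat_eq_iff G_def N_def .
qed

section \<open>Passing from cyclic permutations to linear sequences\<close>

text \<open>A linear de Bruijn sequence closes up: both \<open>\<Sum>w mod n ^ K\<close> and \<open>\<Sum>w div n\<close> over all
  words are equal, and along the sequence their difference telescopes.\<close>

lemma de_bruijn_seqs_wrap:
  assumes n: "n > 0" and w: "w \<in> de_bruijn_seqs n K"
  shows "w 0 div n = w (n ^ Suc K - 1) mod n ^ K"
proof -
  define m where "m = n ^ K"
  define N where "N = n ^ Suc K"
  obtain N' where N': "N = Suc N'"
    using n by (metis N_def gr0_implies_Suc zero_less_power)
  have bij: "bij_betw w {..<N} {..<N}"
    using w endo_inj_surj[of "{..<N}" w]
    by (auto simp: bij_betw_def de_bruijn_seqs_def N_def PiE_iff)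
  have succ: "w (Suc i) div n = w i mod m" if "Suc i < N" for i
    using that w by (simp add: de_bruijn_seqs_def N_def m_def)
  \<comment> \<open>Any admissible permutation matches the values \<open>x mod m\<close> with the
    values \<open>x div n\<close> and so equates their sums; one exists because the count just
    obtained is positive.\<close>
  have "card (de_bruijn_perms n K) \<noteq> 0"
    unfolding card_de_bruijn_perms[OF n] by simp
  then obtain \<pi> where "\<pi> \<in> de_bruijn_perms n K"
    by (metis card.empty equals0I)
  then have p: "\<pi> permutes {..<N}" and s: "\<And>x. x < N \<Longrightarrow> \<pi> x div n = x mod m"
    by (auto simp: de_bruijn_perms_def N_def m_def)
  have "(\<Sum>i<N. w i mod m) = (\<Sum>x<N. x mod m)"
    using sum.reindex_bij_betw[OF bij, of "\<lambda>x. x mod m"] .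
  also have "\<dots> = (\<Sum>x<N. \<pi> x div n)"
    using s by simp
  also have "\<dots> = (\<Sum>x<N. x div n)"
    using sum.permute[OF p, of "\<lambda>x. x div n"] by (simp add: comp_def)
  also have "\<dots> = (\<Sum>i<N. w i div n)"
    using sum.reindex_bij_betw[OF bij, of "\<lambda>x. x div n"] by simp
  finally have "(\<Sum>i<N'. w i mod m) + w N' mod m = w 0 div n + (\<Sum>i<N'. w (Suc i) div n)"
    unfolding N' sum.lessThan_Suc[of "\<lambda>i. w i mod m"] sum.lessThan_Suc_shift[of "\<lambda>i. w i div n"] .
  moreover have "(\<Sum>i<N'. w (Suc i) div n) = (\<Sum>i<N'. w i mod m)"
    using succ by (intro sum.cong) (auto simp: N')
  ultimately have "w 0 div n = w N' mod m" by simp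
  then show ?thesis using N' by (simp add: N_def m_def)
qed

text \<open>A sequence corresponds to a cyclic admissible permutation together with a start word, by
  iterating the permutation from there. The \<open>N\<close> start words cancel the factor
  \<open>N\<close> in \<open>card_cyclic_de_bruijn_perms\<close>.\<close>

lemma card_de_bruijn_seqs:
  assumes n: "n > 0"
  shows "card (de_bruijn_seqs n K) = fact n ^ (n ^ K)"
proof -
  define m where "m = n ^ K"
  define N where "N = n ^ Suc K"
  have N0: "N > 0" using n by (simp add: N_def)
  let ?C = "{\<pi> \<in> de_bruijn_perms n K. cyclic_on \<pi> {..<N}}"
  let ?f = "\<lambda>(\<pi> :: nat \<Rightarrow> nat, e). \<lambda>i\<in>{..<N}. (\<pi> ^^ i) e"
  have G: "de_bruijn_perms n K = {\<pi>. \<pi> permutes {..<N} \<and> (\<forall>w<N. \<pi> w div n = w mod m)}"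
    by (simp add: de_bruijn_perms_def N_def m_def)
  have S: "de_bruijn_seqs n K = {w \<in> {..<N} \<rightarrow>\<^sub>E {..<N}. inj_on w {..<N} \<and>
        (\<forall>i. Suc i < N \<longrightarrow> w (Suc i) div n = w i mod m)}"
    by (simp add: de_bruijn_seqs_def N_def m_def)
  have "bij_betw ?f (?C \<times> {..<N}) (de_bruijn_seqs n K)"
  proof (rule bij_betw_imageI)
    show "inj_on ?f (?C \<times> {..<N})"
    proof (rule inj_onI, clarify)
      fix \<pi> e \<rho> e'
      assume \<pi>: "\<pi> \<in> de_bruijn_perms n K" "cyclic_on \<pi> {..<N}" and e: "e < N"
        and \<rho>: "\<rho> \<in> de_bruijn_perms n K" "cyclic_on \<rho> {..<N}" and e': "e' < N"
        and eq: "(\<lambda>i\<in>{..<N}. (\<pi> ^^ i) e) = (\<lambda>i\<in>{..<N}. (\<rho> ^^ i) e')"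
      have eqi: "(\<pi> ^^ i) e = (\<rho> ^^ i) e'" if "i < N" for i
        using fun_cong[OF eq, of i] that by simp
      have ee: "e = e'" using eqi[of 0] N0 by simp
      note c\<pi> = cyclic_on_lessThan_funpow[OF \<pi>(2) e]
      note c\<rho> = cyclic_on_lessThan_funpow[OF \<rho>(2) e']
      have "\<pi> x = \<rho> x" for x
      proof (cases "x < N")
        case False
        then show ?thesis using \<pi> \<rho> by (auto simp: G permutes_def)
      next
        case True
        then have "x \<in> (\<lambda>i. (\<pi> ^^ i) e) ` {..<N}"
          using c\<pi>(1) by (simp add: bij_betw_def)
        then obtain i where i: "i < N" "x = (\<pi> ^^ i) e" by auto
        \<comment> \<open>At the last index the lists give no further value; there both permutations
          return to the common start.\<close>
        have "(\<pi> ^^ Suc i) e = (\<rho> ^^ Suc i) e'"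
          using eqi[of "Suc i"] i c\<pi>(2) c\<rho>(2) ee by (cases "Suc i = N") simp_all
        then show ?thesis using i eqi[of i] by simp
      qed
      then show "\<pi> = \<rho> \<and> e = e'" using ee by auto
    qed
    show "?f ` (?C \<times> {..<N}) = de_bruijn_seqs n K"
    proof (intro equalityI subsetI)
      fix w assume "w \<in> ?f ` (?C \<times> {..<N})"
      then obtain \<pi> e where \<pi>: "\<pi> \<in> de_bruijn_perms n K" "cyclic_on \<pi> {..<N}" and e: "e < N"
        and w: "w = (\<lambda>i\<in>{..<N}. (\<pi> ^^ i) e)" by auto
      note c\<pi> = cyclic_on_lessThan_funpow[OF \<pi>(2) e]
      have "inj_on w {..<N}" "w ` {..<N} = {..<N}"
        using c\<pi>(1) by (auto simp: w bij_betw_def inj_on_def)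
      then show "w \<in> de_bruijn_seqs n K"
        using \<pi>(1) by (auto simp: S w G PiE_iff image_subset_iff)
    next
      fix w assume w: "w \<in> de_bruijn_seqs n K"
      then have wE: "w \<in> {..<N} \<rightarrow>\<^sub>E {..<N}" and inj: "inj_on w {..<N}"
        and succ: "\<And>i. Suc i < N \<Longrightarrow> w (Suc i) div n = w i mod m"
        by (auto simp: S)
      have im: "w ` {..<N} = {..<N}"
        using wE inj by (intro endo_inj_surj) auto
      have wrap: "w (Suc i mod N) div n = w i mod m" if "i < N" for i
      proof (cases "Suc i = N")
        case True
        then show ?thesis
          using de_bruijn_seqs_wrap[OF n w] unfolding N_def[symmetric] m_def[symmetric]
          by (metis diff_Suc_1 mod_self)
      next
        case False
        with that succ show ?thesis by simp
      qed
      \<comment> \<open>Each word goes to the next one in \<open>w\<close> and the last to the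
        first; \<open>wrap\<close> makes this admissible at the last word too.\<close>
      define \<pi> where "\<pi> = (\<lambda>x. if x < N then w (Suc (the_inv_into {..<N} w x) mod N) else x)"
      have wN: "w i < N" if "i < N" for i using wE that by auto
      have \<pi>w: "\<pi> (w i) = w (Suc i mod N)" if "i < N" for i
        using that wN[OF that] inj by (simp add: \<pi>_def the_inv_into_f_f)
      have ex: "\<exists>i<N. x = w i" if "x < N" for x
        using im that by (metis imageE lessThan_iff)
      have p: "\<pi> permutes {..<N}"
      proof (rule permutes_lessThanI)
        show "\<pi> x < N" if "x < N" for x
          using ex[OF that] \<pi>w wN N0 by auto
        show "inj_on \<pi> {..<N}"
        proof (rule inj_onI)
          fix x y assume xy: "x \<in> {..<N}" "y \<in> {..<N}" "\<pi> x = \<pi> y"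
          obtain i j where ij: "i < N" "x = w i" "j < N" "y = w j"
            using xy ex by (metis lessThan_iff)
          then have "w (Suc i mod N) = w (Suc j mod N)"
            using xy(3) \<pi>w by simp
          then have "Suc i mod N = Suc j mod N"
            using inj_on_eq_iff[OF inj, of "Suc i mod N" "Suc j mod N"] N0 by simp
          then have "i = j"
            using ij by (cases "Suc i = N"; cases "Suc j = N") auto
          with ij show "x = y" by simp
        qed
      qed (simp add: \<pi>_def)
      have "\<pi> x div n = x mod m" if "x < N" for x
        using ex[OF that] \<pi>w wrap by auto
      with p have \<pi>G: "\<pi> \<in> de_bruijn_perms n K" by (simp add: G)
      have pow: "(\<pi> ^^ i) (w 0) = w i" if "i < N" for i
        using that by (induction i) (simp_all add: \<pi>w)
      have perm: "permutation \<pi>" using p by (auto simp: permutation_permutes)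
      have "{..<N} \<subseteq> orbit \<pi> (w 0)"
      proof
        fix x assume "x \<in> {..<N}"
        then obtain i where "i < N" "x = w i" using ex by auto
        with pow show "x \<in> orbit \<pi> (w 0)"
          unfolding orbit_altdef_permutation[OF perm] by (metis (mono_tags, lifting) mem_Collect_eq)
      qed
      then have "{..<N} = orbit \<pi> (w 0)"
        using permutes_orbit_subset[OF p] wN[OF N0] by auto
      then have cyc: "cyclic_on \<pi> {..<N}"
        using wN[OF N0] unfolding cyclic_on_def by blast
      have "w = ?f (\<pi>, w 0)"
        using wE pow by (auto simp: fun_eq_iff PiE_iff extensional_def)
      moreover have "(\<pi>, w 0) \<in> ?C \<times> {..<N}" using \<pi>G cyc wN[OF N0] by simp
      ultimately show "w \<in> ?f ` (?C \<times> {..<N})" by (rule image_eqI)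
    qed
  qed
  then have "card (de_bruijn_seqs n K) = N * card ?C"
    by (simp add: bij_betw_same_card[symmetric] card_cartesian_product)
  then show ?thesis
    using card_cyclic_de_bruijn_perms[OF n, of K] card_de_bruijn_perms[OF n, of K]
    by (simp add: N_def)
qed

subsection \<open>Straight instances\<close>

text \<open>A nonempty row is determined by its left end, so these cells stand for the instances of
  the straight shape of size \<open>k > 0\<close>.\<close>

definition anchors :: "nat \<Rightarrow> cell set \<Rightarrow> cell set" where
  "anchors k P = {z. {fst z..<fst z + int k} \<times> {snd z} \<subseteq> P}"

definition window :: "nat \<Rightarrow> (cell \<Rightarrow> nat) \<Rightarrow> cell \<Rightarrow> nat \<Rightarrow> nat" where
  "window k c z = (\<lambda>j\<in>{..<k}. c (fst z + int j, snd z))"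

lemma mem_anchors_iff: "z \<in> anchors k P \<longleftrightarrow> (\<forall>j<k. (fst z + int j, snd z) \<in> P)"
proof
  assume *: "\<forall>j<k. (fst z + int j, snd z) \<in> P"
  have "(a, snd z) \<in> P" if "fst z \<le> a" "a < fst z + int k" for a
    using *[rule_format, of "nat (a - fst z)"] that by simp
  then show "z \<in> anchors k P" by (auto simp: anchors_def)
qed (auto simp: anchors_def)

lemma ball_row_iff:
  "(\<forall>z \<in> {x..<x + int k} \<times> {y}. Q z) \<longleftrightarrow> (\<forall>j<k. Q (x + int j, y))"
proof
  assume *: "\<forall>j<k. Q (x + int j, y)"
  have "Q (a, y)" if "x \<le> a" "a < x + int k" for a
    using *[rule_format, of "nat (a - x)"] that by simp
  then show "\<forall>z \<in> {x..<x + int k} \<times> {y}. Q z" by auto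
qed auto

lemma translate_row:
  "translate v ({x..<x + int k} \<times> {y}) = {x + fst v..<x + fst v + int k} \<times> {y + snd v}"
proof -
  have "z \<in> translate v ({x..<x + int k} \<times> {y})"
    if "z \<in> {x + fst v..<x + fst v + int k} \<times> {y + snd v}" for z
    unfolding translate_def using that
    by (intro image_eqI[where x = "(fst z - fst v, y)"]) (auto simp: prod_eq_iff)
  moreover have "translate v ({x..<x + int k} \<times> {y}) \<subseteq> {x + fst v..<x + fst v + int k} \<times> {y + snd v}"
    by (auto simp: translate_def plus_prod_def)
  ultimately show ?thesis by blast
qed

lemma row_eq_iff:
  fixes x x' y y' :: int
  shows "k > 0 \<Longrightarrow> {x..<x + int k} \<times> {y} = {x'..<x' + int k} \<times> {y'} \<longleftrightarrow> x = x' \<and> y = y'"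
  by (auto simp: times_eq_iff dest: atLeastLessThan_inj(1))

lemma colored_instance_row_iff:
  "colored_instance ({x..<x + int k} \<times> {y}) f P c S \<longleftrightarrow>
     (\<exists>z\<in>anchors k P. S = {fst z..<fst z + int k} \<times> {snd z} \<and>
        window k c z = (\<lambda>j\<in>{..<k}. f (x + int j, y)))" (is "?l \<longleftrightarrow> ?r")
proof
  assume ?l
  then obtain v where S: "S \<subseteq> P" "S = {x + fst v..<x + fst v + int k} \<times> {y + snd v}"
    and c: "\<forall>j<k. c ((x + int j, y) + v) = f (x + int j, y)"
    unfolding colored_instance_def translate_row ball_row_iff by blast
  then show ?r
    by (intro bexI[of _ "(x + fst v, y + snd v)"])
       (auto simp: anchors_def window_def fun_eq_iff plus_prod_def algebra_simps)
next
  assume ?r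
  then obtain z where z: "{fst z..<fst z + int k} \<times> {snd z} \<subseteq> P"
     "S = {fst z..<fst z + int k} \<times> {snd z}" "window k c z = (\<lambda>j\<in>{..<k}. f (x + int j, y))"
    by (auto simp: anchors_def)
  have "c (fst z + int j, snd z) = f (x + int j, y)" if "j < k" for j
    using fun_cong[OF z(3), of j] that by (simp add: window_def)
  then show ?l
    unfolding colored_instance_def translate_row ball_row_iff using z(1,2)
    by (intro conjI exI[of _ "(fst z - x, snd z - y)"]) (auto simp: algebra_simps)
qed

lemma bij_betw_row_colorings:
  "bij_betw (\<lambda>f. \<lambda>j\<in>{..<k}. f (x + int j, y))
           (colorings ({x..<x + int k} \<times> {y}) n) ({..<k} \<rightarrow>\<^sub>E {1..n})"
proof (rule bij_betw_byWitness[where f' = "\<lambda>h. \<lambda>z\<in>{x..<x + int k} \<times> {y}. h (nat (fst z - x))"])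
  show "\<forall>f\<in>colorings ({x..<x + int k} \<times> {y}) n.
      (\<lambda>z\<in>{x..<x + int k} \<times> {y}. (\<lambda>j\<in>{..<k}. f (x + int j, y)) (nat (fst z - x))) = f"
    by (fastforce simp: colorings_def fun_eq_iff PiE_iff extensional_def)
  show "\<forall>h\<in>{..<k} \<rightarrow>\<^sub>E {1..n}.
      (\<lambda>j\<in>{..<k}. (\<lambda>z\<in>{x..<x + int k} \<times> {y}. h (nat (fst z - x))) (x + int j, y)) = h"
    by (auto simp: fun_eq_iff PiE_iff extensional_def)
  show "(\<lambda>f. \<lambda>j\<in>{..<k}. f (x + int j, y)) ` colorings ({x..<x + int k} \<times> {y}) n \<subseteq> {..<k} \<rightarrow>\<^sub>E {1..n}"
  proof (rule image_subsetI, unfold restrict_PiE_iff, rule ballI)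
    fix f j assume f: "f \<in> colorings ({x..<x + int k} \<times> {y}) n" and j: "j \<in> {..<k}"
    show "f (x + int j, y) \<in> {1..n}"
      by (rule PiE_mem[OF f[unfolded colorings_def]]) (use j in simp)
  qed
  show "(\<lambda>h. \<lambda>z\<in>{x..<x + int k} \<times> {y}. h (nat (fst z - x))) ` ({..<k} \<rightarrow>\<^sub>E {1..n}) \<subseteq>
      colorings ({x..<x + int k} \<times> {y}) n"
    unfolding colorings_def
  proof (rule image_subsetI, unfold restrict_PiE_iff, rule ballI)
    fix h z assume h: "h \<in> {..<k} \<rightarrow>\<^sub>E {1..n}" and z: "z \<in> {x..<x + int k} \<times> {y}"
    show "h (nat (fst z - x)) \<in> {1..n}"
      by (rule PiE_mem[OF h]) (use z in auto)
  qed
qed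

lemma ex1_inj_image_iff:
  assumes "inj R"
  shows "(\<exists>!S. \<exists>z\<in>A. S = R z \<and> Q z) \<longleftrightarrow> (\<exists>!z. z \<in> A \<and> Q z)"
proof
  assume "\<exists>!S. \<exists>z\<in>A. S = R z \<and> Q z"
  then obtain S z where uniq: "\<And>S'. (\<exists>z\<in>A. S' = R z \<and> Q z) \<Longrightarrow> S' = S" and z: "z \<in> A" "Q z"
    by (elim ex1E) blast
  show "\<exists>!z. z \<in> A \<and> Q z"
  proof (rule ex1I[of _ z])
    fix z' assume "z' \<in> A \<and> Q z'"
    then have "R z' = S" "R z = S" using uniq z by blast+
    then show "z' = z" using injD[OF assms] by simp
  qed (use z in simp)
next
  assume "\<exists>!z. z \<in> A \<and> Q z"
  then obtain z where z: "z \<in> A" "Q z" and uniq: "\<And>z'. z' \<in> A \<Longrightarrow> Q z' \<Longrightarrow> z' = z"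
    by (elim ex1E) blast
  show "\<exists>!S. \<exists>z\<in>A. S = R z \<and> Q z"
    by (rule ex1I[of _ "R z"]) (use z uniq in blast)+
qed

lemma bij_betw_iff_ex1:
  assumes "f ` A \<subseteq> B"
  shows "bij_betw f A B \<longleftrightarrow> (\<forall>b\<in>B. \<exists>!a. a \<in> A \<and> f a = b)"
proof
  assume bij: "bij_betw f A B"
  show "\<forall>b\<in>B. \<exists>!a. a \<in> A \<and> f a = b"
  proof
    fix b assume "b \<in> B"
    then obtain a where a: "a \<in> A" "f a = b" using bij by (auto simp: bij_betw_def)
    show "\<exists>!a. a \<in> A \<and> f a = b"
      by (rule ex1I[of _ a]) (use a bij_betw_imp_inj_on[OF bij] in \<open>auto dest: inj_onD\<close>)
  qed
next
  assume *: "\<forall>b\<in>B. \<exists>!a. a \<in> A \<and> f a = b"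
  have "inj_on f A"
  proof (rule inj_onI)
    fix x y assume xy: "x \<in> A" "y \<in> A" "f x = f y"
    then have "\<exists>!a. a \<in> A \<and> f a = f y" using * assms by blast
    with xy show "x = y" by blast
  qed
  moreover have "B \<subseteq> f ` A" using * by blast
  ultimately show "bij_betw f A B" using assms by (auto simp: bij_betw_def)
qed

lemma window_image:
  assumes "c \<in> colorings P n"
  shows "window k c ` anchors k P \<subseteq> {..<k} \<rightarrow>\<^sub>E {1..n}"
proof (rule image_subsetI, unfold window_def restrict_PiE_iff, rule ballI)
  fix z j assume "z \<in> anchors k P" "j \<in> {..<k}"
  then show "c (fst z + int j, snd z) \<in> {1..n}"
    by (intro PiE_mem[OF assms[unfolded colorings_def]]) (simp add: mem_anchors_iff)
qed

text \<open>Instances correspond to anchors and colorings of \<open>p\<close> to words of length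
  \<open>k\<close>, so unique occurrence of every coloring becomes bijectivity of
  \<open>window\<close>.\<close>

lemma de_bruijn_polyomino_row_iff:
  assumes k: "k > 0" and p: "straight_polyomino k p"
  shows "de_bruijn_polyomino p n P c \<longleftrightarrow> polyomino P \<and> c \<in> colorings P n \<and>
           bij_betw (window k c) (anchors k P) ({..<k} \<rightarrow>\<^sub>E {1..n})"
proof -
  obtain x y where p: "p = {x..<x + int k} \<times> {y}"
    using p by (auto simp: straight_polyomino_def)
  let ?W = "{..<k} \<rightarrow>\<^sub>E {1..n}"
  let ?h = "\<lambda>f. \<lambda>j\<in>{..<k}. f (x + int j, y)"
  have "(\<exists>!S. colored_instance p f P c S) \<longleftrightarrow> (\<exists>!z. z \<in> anchors k P \<and> window k c z = ?h f)" for f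
  proof -
    let ?R = "\<lambda>z :: cell. {fst z..<fst z + int k} \<times> {snd z}"
    have "inj ?R"
      by (rule injI) (simp only: row_eq_iff[OF k] prod_eq_iff)
    then show ?thesis
      unfolding p colored_instance_row_iff by (rule ex1_inj_image_iff)
  qed
  then have "(\<forall>f\<in>colorings p n. \<exists>!S. colored_instance p f P c S) \<longleftrightarrow>
      (\<forall>h\<in>?h ` colorings p n. \<exists>!z. z \<in> anchors k P \<and> window k c z = h)"
    by simp
  also have "?h ` colorings p n = ?W"
    using bij_betw_row_colorings unfolding p by (rule bij_betw_imp_surj_on)
  finally have *: "(\<forall>f\<in>colorings p n. \<exists>!S. colored_instance p f P c S) \<longleftrightarrow>
      (\<forall>h\<in>?W. \<exists>!z. z \<in> anchors k P \<and> window k c z = h)" .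
  have "c \<in> colorings P n \<Longrightarrow> (\<forall>h\<in>?W. \<exists>!z. z \<in> anchors k P \<and> window k c z = h) \<longleftrightarrow>
      bij_betw (window k c) (anchors k P) ?W"
    by (intro bij_betw_iff_ex1[symmetric] window_image)
  then show ?thesis
    unfolding de_bruijn_polyomino_def * by blast
qed

section \<open>Sizes of cell sets with a given number of anchors\<close>

text \<open>The \<open>k - 1\<close> cells after the last anchor of a row are not anchors; if there are no other
  non-anchors, then the anchors form a single interval.\<close>

lemma anchors_card:
  assumes fin: "finite P" and k: "k > 0" and ne: "anchors k P \<noteq> {}"
  shows "card (anchors k P) + (k - 1) \<le> card P"
    and "k > 1 \<Longrightarrow> card P = card (anchors k P) + (k - 1) \<Longrightarrow> straight_polyomino (card P) P"
proof -
  let ?A = "anchors k P"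
  have AP: "?A \<subseteq> P"
  proof
    fix z assume "z \<in> ?A"
    then show "z \<in> P" using mem_anchors_iff[of z k P] k by (auto dest!: spec[of _ 0])
  qed
  then have finA: "finite ?A" using fin finite_subset by blast
  have last: "\<exists>x\<ge>a. (x, b) \<in> ?A \<and> (\<forall>x'. (x', b) \<in> ?A \<longrightarrow> x' \<le> x)" if "(a, b) \<in> ?A" for a b
  proof -
    let ?X = "{x. (x, b) \<in> ?A}"
    have "?X = fst ` (?A \<inter> UNIV \<times> {b})" by force
    then have fX: "finite ?X" using finA by simp
    have "a \<in> ?X" using that by simp
    then have "Max ?X \<in> ?X" using Max_in[OF fX] by blast
    moreover have "\<forall>x'\<in>?X. x' \<le> Max ?X" using fX by simp
    ultimately show ?thesis using \<open>a \<in> ?X\<close> by (intro exI[of _ "Max ?X"]) auto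
  qed
  obtain x0 y where "(x0, y) \<in> ?A" using ne by auto
  then obtain x where x: "(x, y) \<in> ?A" and xmax: "\<And>x'. (x', y) \<in> ?A \<Longrightarrow> x' \<le> x"
    using last by blast
  \<comment> \<open>The cells after the rightmost anchor \<open>x\<close> of row \<open>y\<close>,
    in the instance that starts there.\<close>
  let ?R = "{x+1..<x + int k} \<times> {y}"
  have RP: "?R \<subseteq> P" using x by (auto simp: anchors_def)
  have disj: "?A \<inter> ?R = {}" using xmax by force
  have cR: "card ?R = k - 1" by (simp add: card_cartesian_product)
  have cU: "card (?A \<union> ?R) = card ?A + (k - 1)"
    using card_Un_disjoint[OF finA _ disj] cR by simp
  show "card ?A + (k - 1) \<le> card P"
    using card_mono[OF fin, of "?A \<union> ?R"] AP RP cU by simp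
  show "straight_polyomino (card P) P" if k1: "k > 1" and eq: "card P = card ?A + (k - 1)"
  proof -
    have P: "P = ?A \<union> ?R"
      using AP RP eq cU fin by (intro card_subset_eq[symmetric]) auto
    have row: "b = y" if ab: "(a, b) \<in> ?A" for a b
    proof (rule ccontr)
      assume "b \<noteq> y"
      \<comment> \<open>In another row the cell to the right of the last anchor would belong to
        \<open>P\<close> without being an anchor or lying in \<open>?R\<close>; \<open>k > 1\<close>
        ensures that it belongs to \<open>P\<close>.\<close>
      obtain x' where x': "(x', b) \<in> ?A" "\<And>x''. (x'', b) \<in> ?A \<Longrightarrow> x'' \<le> x'"
        using last[OF ab] by blast
      have "(x' + 1, b) \<in> P" using x'(1) k1 by (auto simp: anchors_def)
      moreover have "(x' + 1, b) \<notin> ?A" using x'(2)[of "x' + 1"] by auto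
      ultimately show False using P \<open>b \<noteq> y\<close> by auto
    qed
    let ?X = "fst ` ?A"
    have X: "a \<in> ?X \<longleftrightarrow> (a, y) \<in> ?A" for a using row by force
    define l where "l = Min ?X"
    have l: "(l, y) \<in> ?A" "\<And>a. (a, y) \<in> ?A \<Longrightarrow> l \<le> a"
      using Min_in[of ?X] finA ne X by (auto simp: l_def)
    \<comment> \<open>No gaps: the right neighbour of an anchor left of \<open>x\<close> is in
      \<open>P\<close> but not in \<open>?R\<close>, so it is an anchor.\<close>
    have step: "(a + 1, y) \<in> ?A" if "(a, y) \<in> ?A" "a < x" for a
    proof -
      have "(a + 1, y) \<in> P" using that k1 by (auto simp: anchors_def)
      then show ?thesis using P that by auto
    qed
    have mem: "a \<le> x \<longrightarrow> (a, y) \<in> ?A" if "l \<le> a" for a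
      using that by (induction a rule: int_ge_induct) (use l(1) step in auto)
    have "P = {l..<x + int k} \<times> {y}"
    proof (intro equalityI subsetI)
      fix z assume "z \<in> P"
      then consider a where "z = (a, y)" "(a, y) \<in> ?A" | "z \<in> ?R"
        using P row by (metis UnE surj_pair)
      then show "z \<in> {l..<x + int k} \<times> {y}"
      proof cases
        case (1 a)
        then show ?thesis using l(2)[of a] xmax[of a] k by simp
      next
        case 2
        then show ?thesis using l(2)[OF x] by auto
      qed
    next
      fix z assume "z \<in> {l..<x + int k} \<times> {y}"
      then show "z \<in> P"
        using P mem by (cases z; cases "fst z \<le> x") auto
    qed
    moreover from this have "card P = nat (x + int k - l)"
      by (simp add: card_cartesian_product)
    moreover have "l \<le> x" using l x by simp
    ultimately show ?thesis
      unfolding straight_polyomino_def by (intro exI[of _ l] exI[of _ y]) simp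
  qed
qed

lemma anchors_row:
  assumes "P = {x..<x + int (N + K)} \<times> {y}"
  shows "anchors (Suc K) P = {x..<x + int N} \<times> {y}"
proof (intro equalityI subsetI)
  fix z assume "z \<in> anchors (Suc K) P"
  then have "(fst z + int 0, snd z) \<in> P" "(fst z + int K, snd z) \<in> P"
    unfolding mem_anchors_iff by blast+
  then show "z \<in> {x..<x + int N} \<times> {y}"
    unfolding assms by (cases z) auto
next
  fix z assume "z \<in> {x..<x + int N} \<times> {y}"
  then show "z \<in> anchors (Suc K) P"
    unfolding mem_anchors_iff assms by (cases z) auto
qed

lemma polyomino_straight:
  assumes k: "k > 0" and P: "straight_polyomino k P"
  shows "polyomino P"
proof -
  obtain x y where P: "P = {x..<x + int k} \<times> {y}"
    using P by (auto simp: straight_polyomino_def)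
  let ?r = "{(a, b). a \<in> P \<and> b \<in> P \<and> edge_adjacent a b}"
  have path: "b < x + int k \<longrightarrow> ((a, y), (b, y)) \<in> ?r\<^sup>*" if "x \<le> a" "a \<le> b" for a b
    using that(2)
  proof (induction b rule: int_ge_induct)
    case (step b)
    show ?case
    proof
      assume "b + 1 < x + int k"
      with step that have "((b, y), (b + 1, y)) \<in> ?r"
        by (auto simp: P edge_adjacent_def)
      moreover have "((a, y), (b, y)) \<in> ?r\<^sup>*" using step \<open>b + 1 < x + int k\<close> by simp
      ultimately show "((a, y), (b + 1, y)) \<in> ?r\<^sup>*" by (rule rtrancl_into_rtrancl[rotated])
    qed
  qed simp
  have "sym ?r" by (auto simp: sym_def edge_adjacent_def abs_minus_commute)
  then have sym: "sym (?r\<^sup>*)" by (rule sym_rtrancl)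
  have "(u, v) \<in> ?r\<^sup>*" if "u \<in> P" "v \<in> P" for u v
  proof -
    obtain a where a: "u = (a, y)" "x \<le> a" "a < x + int k"
      using \<open>u \<in> P\<close> unfolding P by auto
    obtain b where b: "v = (b, y)" "x \<le> b" "b < x + int k"
      using \<open>v \<in> P\<close> unfolding P by auto
    show ?thesis
    proof (cases "a \<le> b")
      case True
      with path a b show ?thesis by simp
    next
      case False
      with path[of b a] a b have "(v, u) \<in> ?r\<^sup>*" by simp
      with sym show ?thesis by (rule symD)
    qed
  qed
  then have "edge_connected P" by (simp add: edge_connected_def)
  moreover have "P \<noteq> {}" "finite P" using k by (auto simp: P)
  ultimately show ?thesis by (simp add: polyomino_def)
qed

subsection \<open>Colorings of a row\<close>

text \<open>Base \<open>n\<close> value of \<open>j\<close> letters of \<open>s\<close> from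
  position \<open>i\<close> on, the first one most significant as in the encoding of words
  above.\<close>

primrec word_code :: "nat \<Rightarrow> (nat \<Rightarrow> nat) \<Rightarrow> nat \<Rightarrow> nat \<Rightarrow> nat" where
  "word_code n s i 0 = 0"
| "word_code n s i (Suc j) = n * word_code n s i j + s (i + j)"

lemma word_code_less:
  assumes "\<And>t. t < j \<Longrightarrow> s (i + t) < n"
  shows "word_code n s i j < n ^ j"
  using assms by (induction j) (simp_all add: append_digit_less)

lemma word_code_front:
  "word_code n s i (Suc j) = s i * n ^ j + word_code n s (Suc i) j"
  by (induction j) (simp_all add: algebra_simps)

lemma word_code_eqD:
  assumes "word_code n s i j = word_code n s' i' j"
    and "\<And>t. t < j \<Longrightarrow> s (i + t) < n" "\<And>t. t < j \<Longrightarrow> s' (i' + t) < n"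
  shows "t < j \<Longrightarrow> s (i + t) = s' (i' + t)"
  using assms
proof (induction j arbitrary: t)
  case (Suc j)
  have "n * word_code n s i j + s (i + j) = n * word_code n s' i' j + s' (i' + j)"
    using Suc.prems(2) by simp
  then have "word_code n s i j = word_code n s' i' j" "s (i + j) = s' (i' + j)"
    using append_digit_eq_iff[of "s (i + j)" n "s' (i' + j)"] Suc.prems(3)[of j] Suc.prems(4)[of j]
    by auto
  with Suc show ?case by (cases "t = j") auto
qed simp

lemma word_code_cong:
  assumes "\<And>t. t < j \<Longrightarrow> s (i + t) = s' (i' + t)"
  shows "word_code n s i j = word_code n s' i' j"
  using assms by (induction j) simp_all

text \<open>The first letters of the words, read cyclically, give back the words: \<open>j\<close>
  of them form the prefix of length \<open>j\<close> of word \<open>i\<close>. In the induction the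
  first letter is split off, and the others form a prefix of the next word, which at the end is the
  first word again.\<close>

lemma word_code_de_bruijn_seq:
  assumes n: "n > 0" and w: "w \<in> de_bruijn_seqs n K" and j: "j \<le> Suc K"
  shows "word_code n (\<lambda>i. w (i mod n ^ Suc K) div n ^ K) i j =
           w (i mod n ^ Suc K) div n ^ (Suc K - j)"
  using j
proof (induction j arbitrary: i)
  case 0
  have "n ^ Suc K > 0" using n by simp
  then have "w (i mod n ^ Suc K) < n ^ Suc K"
    using w by (auto simp: de_bruijn_seqs_def simp del: power_Suc)
  then show ?case by simp
next
  case (Suc j)
  define N where "N = n ^ Suc K"
  have N: "N > 0" using n by (simp add: N_def)
  define q where "q = n ^ (K - j)"
  have q: "q > 0" using n by (simp add: q_def)
  have K: "n ^ K = n ^ j * q"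
    using Suc.prems by (simp add: q_def flip: power_add)
  have next_word: "w (Suc i mod N) div n = w (i mod N) mod n ^ K"
  proof (cases "Suc (i mod N) = N")
    case True
    then have "Suc i mod N = 0" by (simp add: mod_Suc)
    moreover have "i mod N = N - 1" using True by linarith
    ultimately show ?thesis
      using de_bruijn_seqs_wrap[OF n w, folded N_def] by simp
  next
    case False
    then have "Suc (i mod N) < N" using N mod_less_divisor[of N i] by linarith
    moreover have "\<forall>i. Suc i < N \<longrightarrow> w (Suc i) div n = w i mod n ^ K"
      using w unfolding de_bruijn_seqs_def N_def by blast
    ultimately show ?thesis
      using False by (simp add: mod_Suc)
  qed
  have "word_code n (\<lambda>i. w (i mod N) div n ^ K) i (Suc j) =
      w (i mod N) div n ^ K * n ^ j + w (Suc i mod N) div n ^ (Suc K - j)"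
    unfolding word_code_front using Suc by (simp add: N_def)
  also have "n ^ (Suc K - j) = n * q"
    using Suc.prems by (simp add: q_def Suc_diff_le)
  also have "w (Suc i mod N) div (n * q) = w (i mod N) mod n ^ K div q"
    by (simp add: div_mult2_eq next_word)
  also have "w (i mod N) div n ^ K * n ^ j + w (i mod N) mod n ^ K div q =
      (w (i mod N) mod n ^ K + w (i mod N) div n ^ K * n ^ j * q) div q"
    using q by simp
  also have "w (i mod N) mod n ^ K + w (i mod N) div n ^ K * n ^ j * q = w (i mod N)"
    unfolding mult.assoc K[symmetric] by (rule mod_div_mult_eq)
  finally show ?case by (simp add: N_def q_def)
qed

text \<open>Colors lowered by 1 serve as base \<open>n\<close> digits, and \<open>code c i\<close>
  encodes the window at position \<open>i\<close>. Listing these codes is a bijection from the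
  colorings sought to \<open>de_bruijn_seqs n K\<close>.\<close>

lemma card_row_de_bruijn_colorings:
  fixes n K :: nat and x y :: int
  defines "N \<equiv> n ^ Suc K"
  defines "P \<equiv> {x..<x + int (N + K)} \<times> {y}"
  assumes n: "n > 0"
  shows "card {c \<in> colorings P n. bij_betw (window (Suc K) c) (anchors (Suc K) P)
                 ({..<Suc K} \<rightarrow>\<^sub>E {1..n})} = fact n ^ (n ^ K)" (is "card ?C = _")
proof -
  have N: "N > 0" using n by (simp add: N_def)
  define str :: "(cell \<Rightarrow> nat) \<Rightarrow> nat \<Rightarrow> nat" where "str = (\<lambda>c i. c (x + int i, y) - 1)"
  define code where "code = (\<lambda>c i. word_code n (str c) i (Suc K))"
  have col: "1 \<le> c (x + int i, y) \<and> c (x + int i, y) \<le> n" if "c \<in> colorings P n" "i < N + K" for c i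
    using PiE_mem[OF that(1)[unfolded colorings_def], of "(x + int i, y)"] that(2) by (simp add: P_def)
  have str_less: "str c i < n" if "c \<in> colorings P n" "i < N + K" for c i
    using col[OF that] unfolding str_def by arith
  have str_eq: "str c i = str d j \<longleftrightarrow> c (x + int i, y) = d (x + int j, y)"
    if "c \<in> colorings P n" "d \<in> colorings P n" "i < N + K" "j < N + K" for c d i j
    using col[OF that(1,3)] col[OF that(2,4)] by (auto simp: str_def)
  have code_eqD: "str c (i + t) = str d (j + t)"
    if "c \<in> colorings P n" "d \<in> colorings P n" "i < N" "j < N" "code c i = code d j" "t < Suc K" for c d i j t
    using that by (intro word_code_eqD[of n "str c" i "Suc K" "str d" j] str_less) (auto simp: code_def)
  have window_eq: "window (Suc K) c (x + int i, y) = window (Suc K) c (x + int j, y) \<longleftrightarrow> code c i = code c j"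
    if c: "c \<in> colorings P n" and ij: "i < N" "j < N" for c i j
  proof -
    have "window (Suc K) c (x + int i, y) = window (Suc K) c (x + int j, y) \<longleftrightarrow>
        (\<forall>t<Suc K. c (x + int (i + t), y) = c (x + int (j + t), y))"
      by (auto simp: window_def fun_eq_iff algebra_simps)
    also have "\<dots> \<longleftrightarrow> (\<forall>t<Suc K. str c (i + t) = str c (j + t))"
      using str_eq[OF c c] ij by (auto simp: less_Suc_eq_le)
    also have "\<dots> \<longleftrightarrow> code c i = code c j"
      using code_eqD[OF c c ij] by (auto simp: code_def intro!: word_code_cong simp del: word_code.simps)
    finally show ?thesis .
  qed
  have C: "c \<in> ?C \<longleftrightarrow> c \<in> colorings P n \<and> inj_on (code c) {..<N}" for c
  proof (cases "c \<in> colorings P n")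
    case c: True
    let ?A = "anchors (Suc K) P" and ?W = "{..<Suc K} \<rightarrow>\<^sub>E {1..n}"
    have A: "?A = (\<lambda>i. (x + int i, y)) ` {..<N}"
    proof -
      have "(a, y) \<in> (\<lambda>i. (x + int i, y)) ` {..<N}" if "x \<le> a" "a < x + int N" for a
        using that by (intro image_eqI[where x = "nat (a - x)"]) auto
      then show ?thesis unfolding anchors_row[OF meta_eq_to_obj_eq[OF P_def]] by auto
    qed
    have injA: "inj_on (\<lambda>i. (x + int i, y)) {..<N}" by (simp add: inj_on_def)
    \<comment> \<open>There are as many anchors as words, so injectivity of \<open>window\<close>
      suffices for bijectivity.\<close>
    have cardA: "card ?A = card ?W"
      unfolding A card_image[OF injA] by (simp add: card_PiE N_def)
    have finW: "finite ?W" by (intro finite_PiE) auto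
    have into: "window (Suc K) c ` ?A \<subseteq> ?W"
      by (rule window_image[OF c])
    have "window (Suc K) c ` ?A = ?W" if "inj_on (window (Suc K) c) ?A"
      using card_subset_eq[OF finW into] card_image[OF that] cardA by simp
    then have "bij_betw (window (Suc K) c) ?A ?W \<longleftrightarrow> inj_on (window (Suc K) c) ?A"
      unfolding bij_betw_def by blast
    also have "\<dots> \<longleftrightarrow> inj_on (code c) {..<N}"
      unfolding A comp_inj_on_iff[OF injA, symmetric]
      using window_eq[OF c] by (auto simp: inj_on_def)
    finally show ?thesis using c by simp
  qed simp
  have "bij_betw (\<lambda>c. \<lambda>i\<in>{..<N}. code c i) ?C (de_bruijn_seqs n K)"
  proof (rule bij_betw_imageI)
    show "inj_on (\<lambda>c. \<lambda>i\<in>{..<N}. code c i) ?C"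
    proof (rule inj_onI)
      fix c d assume cd: "c \<in> ?C" "d \<in> ?C" "(\<lambda>i\<in>{..<N}. code c i) = (\<lambda>i\<in>{..<N}. code d i)"
      then have c: "c \<in> colorings P n" and d: "d \<in> colorings P n" by auto
      have code: "code c i = code d i" if "i < N" for i
        using fun_cong[OF cd(3), of i] that by simp
      have "c (x + int i, y) = d (x + int i, y)" if i: "i < N + K" for i
      proof -
        \<comment> \<open>A window containing cell \<open>i\<close>: its own if one starts there,
          otherwise the last window, which covers the final \<open>K\<close> cells.\<close>
        define i' where "i' = min i (N - 1)"
        have i': "i' < N" "i - i' < Suc K" "i' + (i - i') = i"
          using i N by (auto simp: i'_def)
        have "str c i = str d i"
          using code_eqD[OF c d i'(1,1) code[OF i'(1)] i'(2)] i'(3) by simp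
        then show ?thesis using str_eq[OF c d i i] by simp
      qed
      then have "\<forall>z\<in>P. c z = d z"
        unfolding P_def ball_row_iff by blast
      then show "c = d"
        using c d unfolding colorings_def by (intro PiE_ext[of c P _ d]) auto
    qed
    show "(\<lambda>c. \<lambda>i\<in>{..<N}. code c i) ` ?C = de_bruijn_seqs n K"
    proof (intro equalityI subsetI)
      fix w assume "w \<in> (\<lambda>c. \<lambda>i\<in>{..<N}. code c i) ` ?C"
      then obtain c where w: "w = (\<lambda>i\<in>{..<N}. code c i)" and c: "c \<in> colorings P n"
        and inj: "inj_on (code c) {..<N}"
        using C by blast
      have less: "code c i < N" if "i < N" for i
        unfolding code_def N_def using that by (intro word_code_less str_less[OF c]) simp
      have succ: "code c (Suc i) div n = code c i mod n ^ K" if "Suc i < N" for i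
      proof -
        have "word_code n (str c) (Suc i) K < n ^ K"
          using that by (intro word_code_less str_less[OF c]) simp
        then have "code c i mod n ^ K = word_code n (str c) (Suc i) K"
          unfolding code_def word_code_front by simp
        moreover have "str c (Suc i + K) < n" using that by (intro str_less[OF c]) simp
        ultimately show ?thesis using n by (simp add: code_def)
      qed
      have "w \<in> {..<N} \<rightarrow>\<^sub>E {..<N}"
        unfolding w restrict_PiE_iff using less by simp
      moreover have "inj_on w {..<N}"
        using inj by (simp add: w inj_on_def)
      moreover have "\<forall>i. Suc i < N \<longrightarrow> w (Suc i) div n = w i mod n ^ K"
        using succ by (simp add: w)
      ultimately show "w \<in> de_bruijn_seqs n K"
        unfolding de_bruijn_seqs_def N_def[symmetric] by blast
    next
      fix w assume w: "w \<in> de_bruijn_seqs n K"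
      have wE: "w \<in> {..<N} \<rightarrow>\<^sub>E {..<N}" and winj: "inj_on w {..<N}"
        using w by (auto simp: de_bruijn_seqs_def N_def)
      \<comment> \<open>Inverse map: each cell takes the first letter of its word, and the final
        \<open>K\<close> cells continue cyclically with the letters of the initial words.\<close>
      define s where "s = (\<lambda>i. w (i mod N) div n ^ K)"
      have s: "s i < n" for i
      proof -
        have "w (i mod N) < N" using PiE_mem[OF wE, of "i mod N"] N by simp
        then show ?thesis by (simp add: s_def N_def less_mult_imp_div_less)
      qed
      define c where "c = (\<lambda>z\<in>P. Suc (s (nat (fst z - x))))"
      have c: "c \<in> colorings P n"
        using s by (auto simp: c_def colorings_def Suc_le_eq restrict_PiE_iff)
      have strc: "str c i = s i" if "i < N + K" for i
        using that by (simp add: str_def c_def P_def)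
      have code: "code c i = w i" if "i < N" for i
      proof -
        have "code c i = word_code n s i (Suc K)"
          unfolding code_def using that by (intro word_code_cong strc) simp
        also have "\<dots> = w i"
          using word_code_de_bruijn_seq[OF n w, of "Suc K" i] that
          by (simp add: s_def N_def[symmetric] del: word_code.simps power_Suc)
        finally show ?thesis .
      qed
      have "c \<in> ?C"
        unfolding C using c winj code by (auto simp: inj_on_def)
      moreover have "w = (\<lambda>i\<in>{..<N}. code c i)"
        using wE code by (auto simp: fun_eq_iff PiE_iff extensional_def)
      ultimately show "w \<in> (\<lambda>c. \<lambda>i\<in>{..<N}. code c i) ` ?C" by (intro image_eqI)
    qed
  qed
  then show ?thesis
    using card_de_bruijn_seqs[OF n, of K] by (simp add: bij_betw_same_card)
qed

section \<open>Minimal size, minimal shape and number of colorings\<close>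

theorem theorem3p2:
  fixes n k :: nat and p :: "cell set"
  assumes "n > 0" and "k > 1" and "straight_polyomino k p"
  shows "(\<forall>P. (\<exists>c. prismatic p n P c) \<longleftrightarrow> straight_polyomino (n ^ k + k - 1) P) \<and>
         (\<forall>P. straight_polyomino (n ^ k + k - 1) P \<longrightarrow>
            card {c. prismatic p n P c} = fact n ^ (n ^ (k - 1)))"
proof -
  obtain K where K: "k = Suc K" "K > 0"
    using assms(2) by (metis gr0_conv_Suc less_trans zero_less_one One_nat_def Suc_less_eq)
  define L where "L = n ^ k + k - 1"
  have L: "L = n ^ Suc K + K" by (simp add: L_def K)
  have L0: "L > 0" using K by (simp add: L)
  have dB: "de_bruijn_polyomino p n P c \<longleftrightarrow> polyomino P \<and> c \<in> colorings P n \<and>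
      bij_betw (window k c) (anchors k P) ({..<k} \<rightarrow>\<^sub>E {1..n})" for P c
    by (rule de_bruijn_polyomino_row_iff) (use assms in simp_all)
  have size: "L \<le> card P \<and> (card P = L \<longrightarrow> straight_polyomino L P)"
    if "de_bruijn_polyomino p n P c" for P c
  proof -
    have fin: "finite P" and bij: "bij_betw (window k c) (anchors k P) ({..<k} \<rightarrow>\<^sub>E {1..n})"
      using that unfolding dB by (auto simp: polyomino_def)
    have card: "card (anchors k P) = n ^ k"
      using bij_betw_same_card[OF bij] by (simp add: card_PiE)
    then have "anchors k P \<noteq> {}" using assms(1) by auto
    from anchors_card[OF fin _ this] card assms(2) show ?thesis
      by (auto simp: L_def)
  qed
  have count: "card {c. de_bruijn_polyomino p n P c} = fact n ^ (n ^ (k - 1))"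
    if P: "straight_polyomino L P" for P
  proof -
    obtain x y where xy: "P = {x..<x + int (n ^ Suc K + K)} \<times> {y}"
      using P unfolding L straight_polyomino_def by blast
    have "{c. de_bruijn_polyomino p n P c} = {c \<in> colorings P n.
        bij_betw (window (Suc K) c) (anchors (Suc K) P) ({..<Suc K} \<rightarrow>\<^sub>E {1..n})}"
      unfolding dB K(1) using polyomino_straight[OF L0 P] by simp
    then show ?thesis
      using card_row_de_bruijn_colorings[OF assms(1), where K = K and x = x and y = y] by (simp only: xy K(1) diff_Suc_1)
  qed
  have card: "card P = L" if "straight_polyomino L P" for P
    using that by (auto simp: straight_polyomino_def card_cartesian_product)
  have prism: "prismatic p n P c \<longleftrightarrow> de_bruijn_polyomino p n P c"
    if P: "straight_polyomino L P" for P c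
    using card[OF P] size unfolding prismatic_def by auto
  \<comment> \<open>Existence follows from the count, which is a power of a factorial and hence
    nonzero.\<close>
  have ex: "\<exists>c. de_bruijn_polyomino p n P c" if P: "straight_polyomino L P" for P
  proof (rule ccontr)
    assume "\<nexists>c. de_bruijn_polyomino p n P c"
    then have "card {c. de_bruijn_polyomino p n P c} = 0" by simp
    then show False using count[OF P] by simp
  qed
  have "straight_polyomino L P" if "prismatic p n P c" for P c
  proof -
    \<comment> \<open>A concrete row of length \<open>L\<close> carries a de Bruijn coloring and
      bounds the size of any prismatic \<open>P\<close> from above; with the lower bound in
      \<open>size\<close> this forces the straight shape.\<close>
    have Q: "straight_polyomino L ({0..<0 + int L} \<times> {0})"
      unfolding straight_polyomino_def by blast
    obtain d where "de_bruijn_polyomino p n ({0..<0 + int L} \<times> {0}) d"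
      using ex[OF Q] by blast
    then have "card P \<le> L"
      using that card[OF Q] unfolding prismatic_def by metis
    then show ?thesis
      using size[of P c] that unfolding prismatic_def by auto
  qed
  moreover have "\<exists>c. prismatic p n P c" if "straight_polyomino L P" for P
    using ex[OF that] prism[OF that] by blast
  moreover have "card {c. prismatic p n P c} = fact n ^ (n ^ (k - 1))"
    if "straight_polyomino L P" for P
    using count[OF that] prism[OF that] by simp
  ultimately show ?thesis
    unfolding L_def[symmetric] by blast
qed

end
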